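(* Each of the foliations $\mathcal F^a$, $a\in\mathbb C\setminus\mathbb R$, and $\mathcal F_n$, $n\in\mathbb N$, on $S^3$ admits a unique transverse holomorphic structure for the given coorientation. That is, if $\omega_{\mathrm c}'$ is any formally integrable complex $1$-form on $S^3$ defining the same cooriented $1$-dimensional foliation as $\omega^a|_{TS^3}$ (with $a\in\mathbb C\setminus\mathbb R$), respectively as $\omega_n|_{TS^3}$, then $\omega_{\mathrm c}'$ equals $h\,\omega^a|_{TS^3}$, respectively $h\,\omega_n|_{TS^3}$, for some nowhere zero smooth function $h\colon S^3\to\mathbb C$.
   Context: All objects are smooth. $S^3\subset\mathbb C^2$ is the unit sphere and $\mathbb N=\{1,2,3,\ldots\}$. A formally integrable complex $1$-form on $S^3$ is a complex-valued $1$-form $\omega_{\mathrm c}=\omega_1+\mathrm i\omega_2$ with $\omega_1,\omega_2$ pointwise linearly independent and $\omega_{\mathrm c}\wedge\mathrm d\omega_{\mathrm c}=0$. It defines the $1$-dimensional foliation tangent to $\ker\omega_1\cap\ker\omega_2$, cooriented (transversely oriented) by $\omega_1\wedge\omega_2$. A transverse holomorphic structure on a cooriented $1$-dimensional foliation of $S^3$ is a formally integrable complex $1$-form defining that cooriented foliation, considered up to multiplication by nowhere zero smooth complex-valued functions (equivalently, a complex structure on the normal bundle of the foliation that is compatible with the coorientation and invariant under the flow of any vector field generating the foliation). $\mathcal F^a$ is the cooriented foliation on $S^3$ defined by the restriction to $TS^3$ of $\omega^a=a z_1\,\mathrm dz_2-(1-a)z_2\,\mathrm dz_1$. $\mathcal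 F_n$ is the cooriented foliation on $S^3$ defined by the restriction to $TS^3$ of $\omega_n=n z_1\,\mathrm dz_2-z_2\,\mathrm dz_1+z_2^n\,\mathrm dz_2$. *)

theory Defs
  imports "HOL-Analysis.Analysis"
begin

text \<open>
  \<open>Ck_on k U f\<close> is meant for open \<open>U\<close>: it says that \<open>f\<close> is of class \<open>C\<^sup>k\<close> on \<open>U\<close>, over the reals,
  through the existence and continuity of iterated directional derivatives.
\<close>

primrec Ck_on ::
  "nat \<Rightarrow> 'a::real_normed_vector set \<Rightarrow> ('a \<Rightarrow> 'b::real_normed_vector) \<Rightarrow> bool" where
  "Ck_on 0 U f \<longleftrightarrow> continuous_on U f"
| "Ck_on (Suc k) U f \<longleftrightarrow>
     (\<forall>x\<in>U. f differentiable (at x)) \<and>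
     (\<forall>v. Ck_on k U (\<lambda>x. frechet_derivative f (at x) v))"

definition smooth_on ::
  "'a::real_normed_vector set \<Rightarrow> ('a \<Rightarrow> 'b::real_normed_vector) \<Rightarrow> bool" where
  "smooth_on U f \<longleftrightarrow> (\<forall>k. Ck_on k U f)"

type_synonym C2 = "complex \<times> complex"

text \<open>A 1-form assigns to a point \<open>x\<close> and a tangent vector \<open>v\<close> at \<open>x\<close> the number \<open>\<omega> x v\<close>.\<close>

type_synonym one_form = "C2 \<Rightarrow> C2 \<Rightarrow> complex"
type_synonym two_form = "C2 \<Rightarrow> C2 \<Rightarrow> C2 \<Rightarrow> complex"

definition smooth_one_form_on :: "C2 set \<Rightarrow> one_form \<Rightarrow> bool" where
  "smooth_one_form_on U \<Omega> \<longleftrightarrow>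
     (\<forall>x\<in>U. linear (\<Omega> x)) \<and> (\<forall>v. smooth_on U (\<lambda>x. \<Omega> x v))"

definition ext_deriv :: "one_form \<Rightarrow> two_form" where
  "ext_deriv \<Omega> x u v =
     frechet_derivative (\<lambda>y. \<Omega> y v) (at x) u - frechet_derivative (\<lambda>y. \<Omega> y u) (at x) v"

definition S3 :: "C2 set" where
  "S3 = sphere 0 1"

text \<open>The inner product is the real one on \<open>\<complex>\<^sup>2 = \<real>\<^sup>4\<close>.\<close>

definition tangent :: "C2 \<Rightarrow> C2 set" where
  "tangent p = {v. v \<bullet> p = 0}"

definition smooth_S3 :: "(C2 \<Rightarrow> complex) \<Rightarrow> bool" where
  "smooth_S3 h \<longleftrightarrow>
     (\<exists>U H. open U \<and> S3 \<subseteq> U \<and> smooth_on U H \<and> (\<forall>p\<in>S3. h p = H p))"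

text \<open>
  Restriction of forms to \<open>TS\<^sup>3\<close>. Forms on \<open>S\<^sup>3\<close> are represented by functions that are \<open>0\<close> outside
  \<open>TS\<^sup>3\<close>, so that equality of forms on \<open>S\<^sup>3\<close> is equality of functions.
\<close>

definition restrict_S3 :: "one_form \<Rightarrow> one_form" where
  "restrict_S3 \<Omega> = (\<lambda>p v. if p \<in> S3 \<and> v \<in> tangent p then \<Omega> p v else 0)"

definition restrict2_S3 :: "two_form \<Rightarrow> two_form" where
  "restrict2_S3 \<Theta> =
     (\<lambda>p u v. if p \<in> S3 \<and> u \<in> tangent p \<and> v \<in> tangent p then \<Theta> p u v else 0)"

definition smooth_extension :: "C2 set \<Rightarrow> one_form \<Rightarrow> one_form \<Rightarrow> bool" where
  "smooth_extension U \<Omega> \<omega> \<longleftrightarrow>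
     open U \<and> S3 \<subseteq> U \<and> smooth_one_form_on U \<Omega> \<and> \<omega> = restrict_S3 \<Omega>"

definition one_form_S3 :: "one_form \<Rightarrow> bool" where
  "one_form_S3 \<omega> \<longleftrightarrow> (\<exists>U \<Omega>. smooth_extension U \<Omega> \<omega>)"

text \<open>
  The exterior derivative on \<open>S\<^sup>3\<close> is the restriction of the exterior derivative of an arbitrary
  smooth extension; it does not depend on the extension, see \<open>ext_deriv_S3_eq\<close> below.
\<close>

definition ext_deriv_S3 :: "one_form \<Rightarrow> two_form" where
  "ext_deriv_S3 \<omega> =
     (THE \<eta>. \<exists>U \<Omega>. smooth_extension U \<Omega> \<omega> \<and> \<eta> = restrict2_S3 (ext_deriv \<Omega>))"

definition wedge12 ::
  "(C2 \<Rightarrow> complex) \<Rightarrow> (C2 \<Rightarrow> C2 \<Rightarrow> complex) \<Rightarrow> C2 \<Rightarrow> C2 \<Rightarrow> C2 \<Rightarrow> complex" where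
  "wedge12 \<alpha> \<beta> u v w = \<alpha> u * \<beta> v w + \<alpha> v * \<beta> w u + \<alpha> w * \<beta> u v"

definition wedge_Re_Im :: "(C2 \<Rightarrow> complex) \<Rightarrow> C2 \<Rightarrow> C2 \<Rightarrow> real" where
  "wedge_Re_Im \<alpha> u v = Re (\<alpha> u) * Im (\<alpha> v) - Re (\<alpha> v) * Im (\<alpha> u)"

definition formally_integrable :: "one_form \<Rightarrow> bool" where
  "formally_integrable \<omega> \<longleftrightarrow>
     one_form_S3 \<omega> \<and>
     (\<forall>p\<in>S3. \<forall>s t::real.
        (\<forall>v\<in>tangent p. s * Re (\<omega> p v) + t * Im (\<omega> p v) = 0) \<longrightarrow> s = 0 \<and> t = 0) \<and>
     (\<forall>p\<in>S3. \<forall>u\<in>tangent p. \<forall>v\<in>tangent p. \<forall>w\<in>tangent p.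
        wedge12 (\<omega> p) (ext_deriv_S3 \<omega> p) u v w = 0)"

text \<open>
  A cooriented 1-dimensional foliation of \<open>S\<^sup>3\<close> is encoded as a function that assigns to each point
  the tangent line of the leaf and the set of those pairs of tangent vectors that project to positive
  bases of the normal plane (the function is constant outside \<open>S\<^sup>3\<close>).
\<close>

type_synonym cooriented_foliation = "C2 \<Rightarrow> C2 set \<times> (C2 \<times> C2) set"

definition foliation_of :: "one_form \<Rightarrow> cooriented_foliation" where
  "foliation_of \<omega> = (\<lambda>p. if p \<in> S3 then
       ({v \<in> tangent p. Re (\<omega> p v) = 0} \<inter> {v \<in> tangent p. Im (\<omega> p v) = 0},
        {(u, v). u \<in> tangent p \<and> v \<in> tangent p \<and> wedge_Re_Im (\<omega> p) u v > 0})
     else ({}, {}))"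

definition defining_forms :: "cooriented_foliation \<Rightarrow> one_form set" where
  "defining_forms F = {\<omega>. formally_integrable \<omega> \<and> foliation_of \<omega> = F}"

definition smooth_multiple :: "one_form \<Rightarrow> one_form \<Rightarrow> bool" where
  "smooth_multiple \<omega> \<omega>' \<longleftrightarrow>
     (\<exists>h. smooth_S3 h \<and> (\<forall>p\<in>S3. h p \<noteq> 0) \<and> \<omega>' = (\<lambda>p v. h p * \<omega> p v))"

definition transverse_holomorphic_structures :: "cooriented_foliation \<Rightarrow> one_form set set" where
  "transverse_holomorphic_structures F =
     defining_forms F //
       {(\<omega>, \<omega>'). \<omega> \<in> defining_forms F \<and> \<omega>' \<in> defining_forms F \<and> smooth_multiple \<omega> \<omega>'}"

definition omega_a :: "complex \<Rightarrow> one_form" where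
  "omega_a a = (\<lambda>(z1, z2) (v1, v2). a * z1 * v2 - (1 - a) * z2 * v1)"

definition omega_n :: "nat \<Rightarrow> one_form" where
  "omega_n n = (\<lambda>(z1, z2) (v1, v2). of_nat n * z1 * v2 - z2 * v1 + z2 ^ n * v2)"

definition F_a :: "complex \<Rightarrow> cooriented_foliation" where
  "F_a a = foliation_of (restrict_S3 (omega_a a))"

definition F_n :: "nat \<Rightarrow> cooriented_foliation" where
  "F_n n = foliation_of (restrict_S3 (omega_n n))"

lemma smooth_one_form_on_differentiable:
  assumes "smooth_one_form_on U \<Omega>" "x \<in> U"
  shows "(\<lambda>y. \<Omega> y v) differentiable (at x)"
proof -
  have "Ck_on (Suc 0) U (\<lambda>y. \<Omega> y v)"
    using assms unfolding smooth_one_form_on_def smooth_on_def by blast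
  then show ?thesis using assms(2) by simp
qed

lemma frechet_derivative_S3_tangent:
  assumes g: "g differentiable (at p)" and z: "\<And>x. x \<in> S3 \<Longrightarrow> g x = (0::complex)"
    and p: "p \<in> S3" and u: "u \<in> tangent p"
  shows "frechet_derivative g (at p) u = 0"
proof (cases "u = 0")
  case True
  then show ?thesis
    using linear_frechet_derivative[OF g] by (simp add: linear_0)
next
  case False
  define c where "c = norm u"
  have c: "c \<noteq> 0" using False by (simp add: c_def)
  define \<gamma> where "\<gamma> = (\<lambda>t::real. cos (c * t) *\<^sub>R p + (sin (c * t) / c) *\<^sub>R u)"
  have \<gamma>0: "\<gamma> 0 = p" by (simp add: \<gamma>_def)
  have \<gamma>S: "\<gamma> t \<in> S3" for t
  proof -
    have pp: "p \<bullet> p = 1" using p by (simp add: S3_def dot_square_norm)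
    have up: "u \<bullet> p = 0" "p \<bullet> u = 0" using u by (auto simp: tangent_def inner_commute)
    have uu: "u \<bullet> u = c * c" by (simp add: c_def dot_square_norm power2_eq_square)
    have "\<gamma> t \<bullet> \<gamma> t = cos (c * t) * cos (c * t) + sin (c * t) * sin (c * t)"
      using c by (simp add: \<gamma>_def inner_add_left inner_add_right pp up uu)
    then have "\<gamma> t \<bullet> \<gamma> t = 1" by (metis power2_eq_square sin_cos_squared_add2)
    then show ?thesis by (simp add: S3_def norm_eq_sqrt_inner)
  qed
  have d\<gamma>: "(\<gamma> has_derivative (\<lambda>t. t *\<^sub>R u)) (at 0)"
    unfolding \<gamma>_def using c by (auto intro!: derivative_eq_intros)
  have "(g has_derivative frechet_derivative g (at p)) (at (\<gamma> 0))"
    using g \<gamma>0 frechet_derivative_works by auto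
  from has_derivative_compose[OF d\<gamma> this]
  have "((\<lambda>t. g (\<gamma> t)) has_derivative (\<lambda>t. frechet_derivative g (at p) (t *\<^sub>R u))) (at 0)" .
  moreover have "((\<lambda>t. g (\<gamma> t)) has_derivative (\<lambda>t. 0)) (at 0)"
    by (simp add: z[OF \<gamma>S])
  ultimately have "(\<lambda>t. frechet_derivative g (at p) (t *\<^sub>R u)) = (\<lambda>t. 0)"
    by (rule has_derivative_unique)
  from fun_cong[OF this, of 1] show ?thesis by simp
qed

lemma ext_deriv_unique:
  assumes 1: "smooth_extension U1 \<Omega>1 \<omega>" and 2: "smooth_extension U2 \<Omega>2 \<omega>"
  shows "restrict2_S3 (ext_deriv \<Omega>1) = restrict2_S3 (ext_deriv \<Omega>2)"
proof -
  define G where "G = (\<lambda>x v. \<Omega>1 x v - \<Omega>2 x v)"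
  have G0: "G x v = 0" if "x \<in> S3" "v \<in> tangent x" for x v
  proof -
    have "restrict_S3 \<Omega>1 x v = restrict_S3 \<Omega>2 x v"
      using 1 2 by (simp add: smooth_extension_def)
    then show ?thesis using that by (simp add: restrict_S3_def G_def)
  qed
  have lin: "linear (G x)" if "x \<in> S3" for x
    using that 1 2 unfolding G_def smooth_extension_def smooth_one_form_on_def
    by (intro linear_compose_sub) auto
  have d12: "(\<lambda>y. \<Omega>1 y v) differentiable (at x)" "(\<lambda>y. \<Omega>2 y v) differentiable (at x)"
    if "x \<in> S3" for x v
    using 1 2 that smooth_one_form_on_differentiable unfolding smooth_extension_def by blast+
  have dG: "(\<lambda>y. G y v) differentiable (at x)" if "x \<in> S3" for x v
    unfolding G_def using d12[OF that] by (intro differentiable_diff)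
  define f where "f = (\<lambda>x. \<Sum>b\<in>Basis. (x \<bullet> b) *\<^sub>R G x b)"
  have df: "f differentiable (at x)" if "x \<in> S3" for x
    unfolding f_def using dG[OF that] by (intro differentiable_sum ballI derivative_intros) auto
  have fG: "f x = G x x" if "x \<in> S3" for x
  proof -
    have "G x x = G x (\<Sum>b\<in>Basis. (x \<bullet> b) *\<^sub>R b)" by (simp add: euclidean_representation)
    then show ?thesis
      by (simp add: f_def linear_sum[OF lin[OF that]] linear_scale[OF lin[OF that]])
  qed
  have Gv: "G x v - (v \<bullet> x) *\<^sub>R f x = 0" if "x \<in> S3" for x v
  proof -
    have "x \<bullet> x = 1" using that by (simp add: S3_def dot_square_norm)
    then have "v - (v \<bullet> x) *\<^sub>R x \<in> tangent x" by (simp add: tangent_def inner_diff_left)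
    from G0[OF that this] show ?thesis
      by (simp add: fG[OF that] linear_diff[OF lin[OF that]] linear_scale[OF lin[OF that]])
  qed
  have key: "frechet_derivative (\<lambda>y. G y v) (at p) u = (u \<bullet> v) *\<^sub>R f p"
    if p: "p \<in> S3" and u: "u \<in> tangent p" and v: "v \<in> tangent p" for p u v
  proof -
    let ?g = "\<lambda>y. G y v - (v \<bullet> y) *\<^sub>R f y"
    have a: "((\<lambda>y. G y v) has_derivative frechet_derivative (\<lambda>y. G y v) (at p)) (at p)"
      using dG[OF p] frechet_derivative_works by blast
    have b: "(f has_derivative frechet_derivative f (at p)) (at p)"
      using df[OF p] frechet_derivative_works by blast
    have D: "(?g has_derivative (\<lambda>h. frechet_derivative (\<lambda>y. G y v) (at p) h -
        ((v \<bullet> p) *\<^sub>R frechet_derivative f (at p) h + (v \<bullet> h) *\<^sub>R f p))) (at p)"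
      by (rule derivative_eq_intros a b refl | simp)+
    have "frechet_derivative ?g (at p) u = 0"
      by (rule frechet_derivative_S3_tangent[OF _ Gv p u]) (use D in \<open>auto simp: differentiable_def\<close>)
    moreover have "frechet_derivative ?g (at p) = (\<lambda>h. frechet_derivative (\<lambda>y. G y v) (at p) h -
        ((v \<bullet> p) *\<^sub>R frechet_derivative f (at p) h + (v \<bullet> h) *\<^sub>R f p))"
      using frechet_derivative_at[OF D] by simp
    moreover have "v \<bullet> p = 0" using v by (simp add: tangent_def)
    ultimately show ?thesis by (simp add: inner_commute)
  qed
  have sub: "frechet_derivative (\<lambda>y. G y v) (at p) u =
      frechet_derivative (\<lambda>y. \<Omega>1 y v) (at p) u - frechet_derivative (\<lambda>y. \<Omega>2 y v) (at p) u"
    if p: "p \<in> S3" for p u v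
  proof -
    have "((\<lambda>y. G y v) has_derivative (\<lambda>u. frechet_derivative (\<lambda>y. \<Omega>1 y v) (at p) u -
        frechet_derivative (\<lambda>y. \<Omega>2 y v) (at p) u)) (at p)"
      unfolding G_def
      by (intro has_derivative_diff frechet_derivative_works[THEN iffD1] d12[OF p])
    from frechet_derivative_at[OF this] show ?thesis by metis
  qed
  have "ext_deriv \<Omega>1 p u v = ext_deriv \<Omega>2 p u v"
    if p: "p \<in> S3" and u: "u \<in> tangent p" and v: "v \<in> tangent p" for p u v
    using key[OF p u v] key[OF p v u] sub[OF p, of v u] sub[OF p, of u v]
    by (simp add: ext_deriv_def inner_commute algebra_simps)
  then show ?thesis by (auto simp: restrict2_S3_def fun_eq_iff)
qed

lemma ext_deriv_S3_eq:
  assumes "smooth_extension U \<Omega> \<omega>"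
  shows "ext_deriv_S3 \<omega> = restrict2_S3 (ext_deriv \<Omega>)"
  unfolding ext_deriv_S3_def
  by (rule the_equality) (use assms ext_deriv_unique in blast)+

end

theory Submission
  imports Defs "HOL-Real_Asymp.Real_Asymp"
begin

text \<open>
  Both families consist of restrictions to the sphere of holomorphic forms \<open>\<Omega> = A dz\<^sub>1 + B dz\<^sub>2\<close> whose
  kernel, a complex line in each point, is transverse to the sphere. Let \<open>\<omega>'\<close> be another form that
  defines the same cooriented foliation. Pointwise linear algebra gives \<open>\<omega>' = h (\<Omega> + \<mu> \<Omega>\<^sup>*)\<close>, where
  \<open>\<Omega>\<^sup>*\<close> is the conjugate of \<open>\<Omega>\<close>, with smooth functions \<open>h\<close> and \<open>\<mu>\<close>, and \<open>h\<close> has no zeros because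
  of the coorientation (\<open>defining_form_mixed\<close>). The aim is \<open>\<mu> = 0\<close>.

  Integrability of \<open>\<omega>'\<close> is an ordinary differential equation for the Beltrami coefficient \<open>\<mu>\<close> along the
  leaves (\<open>beltrami_equation\<close>). It takes a simple form if \<open>\<Omega> / f\<close> is closed for a holomorphic function \<open>f\<close>:
  where \<open>f\<close> does not vanish, \<open>\<nu> = \<mu> f\<^sup>* / f\<close> is constant on every leaf (\<open>leafwise_constant_quotient\<close>).
  One can take \<open>f = z\<^sub>1 z\<^sub>2\<close> for \<open>\<omega>\<^sup>a\<close> and \<open>f = z\<^sub>2\<^sup>n\<^sup>+\<^sup>1\<close> for \<open>\<omega>\<^sub>n\<close>.

  In both cases \<open>z\<^sub>2 = 0\<close> is a closed leaf that is approached by every leaf in the domain of \<open>\<nu>\<close>. The leaves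
  are described by explicit formulas, and following a leaf to its end expresses the constant \<open>\<nu>\<close>
  through the values of the continuous function \<open>\<mu>\<close> on this circle
  (\<open>leafwise_constant_limit\<close>, \<open>leafwise_constant_value\<close>). It turns out that \<open>\<mu>\<close> is given off
  the closed leaves by an explicit formula with one or two unknown complex factors. But \<open>\<mu>\<close> is
  continuous on the closed leaves, too, and the phase of the formula has no limit there unless the
  factors vanish. For \<open>\<omega>\<^sub>n\<close> this argument applies to the same circle. For \<open>\<omega>\<^sup>a\<close> it is applied to the other
  closed leaf \<open>z\<^sub>1 = 0\<close>, because the phases match on the first one for some values of \<open>a\<close>.
\<close>

section \<open>Calculus of smooth functions\<close>

text \<open>
  The inductive clause of \<open>Ck_on\<close> speaks of the chosen derivative \<open>frechet_derivative\<close>. This lemma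
  and the next one make it possible to work instead with any expression for the derivative, so that
  the closure properties below follow from the usual rules by induction on \<open>k\<close>.
\<close>

lemma Ck_on_cong:
  assumes "open U" and "\<And>x. x \<in> U \<Longrightarrow> f x = g x" and "Ck_on k U f"
  shows "Ck_on k U g"
  using assms(2,3)
proof (induction k arbitrary: f g)
  case 0
  then show ?case using continuous_on_cong[of U U f g] by simp
next
  case (Suc k)
  have fg: "(g has_derivative D) (at x)" if "x \<in> U" "(f has_derivative D) (at x)" for x D
    using has_derivative_transform_within_open[OF that(2) assms(1) that(1)] Suc.prems(1) by blast
  have D: "(f has_derivative frechet_derivative f (at x)) (at x)" if "x \<in> U" for x
    using Suc.prems(2) that frechet_derivative_works by auto
  have eq: "frechet_derivative f (at x) = frechet_derivative g (at x)" if "x \<in> U" for x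
    using frechet_derivative_at[OF fg[OF that D[OF that]]] by simp
  have "Ck_on k U (\<lambda>x. frechet_derivative g (at x) v)" for v
    by (rule Suc.IH[where f = "\<lambda>x. frechet_derivative f (at x) v"])
      (use eq Suc.prems(2) in auto)
  moreover have "g differentiable (at x)" if "x \<in> U" for x
    using fg[OF that D[OF that]] by (auto simp: differentiable_def)
  ultimately show ?case by simp
qed

lemma Ck_on_SucI:
  assumes "open U" and "\<And>x. x \<in> U \<Longrightarrow> (f has_derivative f' x) (at x)"
    and "\<And>v. Ck_on k U (\<lambda>x. f' x v)"
  shows "Ck_on (Suc k) U f"
proof -
  have "Ck_on k U (\<lambda>x. frechet_derivative f (at x) v)" for v
  proof (rule Ck_on_cong[OF assms(1) _ assms(3)])
    show "f' x v = frechet_derivative f (at x) v" if "x \<in> U" for x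
      using frechet_derivative_at[OF assms(2)[OF that]] by simp
  qed
  then show ?thesis using assms(2) by (auto simp: differentiable_def)
qed

lemma Ck_on_derivative:
  assumes "Ck_on (Suc k) U f" "x \<in> U"
  shows "(f has_derivative frechet_derivative f (at x)) (at x)"
  using assms frechet_derivative_works by auto

lemma Ck_on_Suc_imp: "Ck_on (Suc k) U f \<Longrightarrow> Ck_on k U f"
proof (induction k arbitrary: f)
  case 0
  then show ?case
    by (auto intro!: continuous_at_imp_continuous_on differentiable_imp_continuous_within)
next
  case (Suc k)
  from Suc.prems have "f differentiable (at x)" if "x \<in> U" for x
    using that by simp
  moreover have "Ck_on (Suc k) U (\<lambda>x. frechet_derivative f (at x) v)" for v
    using Suc.prems by (subst (asm) Ck_on.simps(2)) blast
  ultimately show ?case using Suc.IH by (subst Ck_on.simps(2)) blast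
qed

lemma Ck_on_const:
  assumes "open U" shows "Ck_on k U (\<lambda>x. c)"
proof (induction k arbitrary: c)
  case (Suc k)
  then show ?case by (intro Ck_on_SucI[OF assms has_derivative_const])
qed simp

lemma Ck_on_add:
  assumes "open U" "Ck_on k U f" "Ck_on k U g"
  shows "Ck_on k U (\<lambda>x. f x + g x)"
  using assms(2,3)
proof (induction k arbitrary: f g)
  case (Suc k)
  then show ?case
    by (intro Ck_on_SucI[OF assms(1) has_derivative_add[OF Ck_on_derivative Ck_on_derivative]]) auto
qed (simp add: continuous_on_add)

lemma Ck_on_linear_compose:
  assumes "open U" "bounded_linear L" "Ck_on k U f"
  shows "Ck_on k U (\<lambda>x. L (f x))"
  using assms(3)
proof (induction k arbitrary: f)
  case 0
  then show ?case using bounded_linear.continuous_on[OF assms(2)] by auto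
next
  case (Suc k)
  then show ?case
    by (intro Ck_on_SucI[OF assms(1) bounded_linear.has_derivative[OF assms(2) Ck_on_derivative]]) auto
qed

lemma Ck_on_bilinear:
  assumes "open U" "bounded_bilinear mul" "Ck_on k U f" "Ck_on k U g"
  shows "Ck_on k U (\<lambda>x. mul (f x) (g x))"
  using assms(3,4)
proof (induction k arbitrary: f g)
  case 0
  then show ?case using bounded_bilinear.continuous_on[OF assms(2)] by auto
next
  case (Suc k)
  have "Ck_on k U f" "Ck_on k U g"
    using Suc.prems[THEN Ck_on_Suc_imp] .
  then show ?case using Suc.prems
    by (intro Ck_on_SucI[OF assms(1) bounded_bilinear.FDERIV[OF assms(2)
          Ck_on_derivative[OF Suc.prems(1)] Ck_on_derivative[OF Suc.prems(2)]]]
        Ck_on_add[OF assms(1)] Suc.IH) simp_all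
qed

lemma Ck_on_inverse:
  fixes f :: "'a::real_normed_vector \<Rightarrow> complex"
  assumes "open U" "Ck_on k U f" "\<And>x. x \<in> U \<Longrightarrow> f x \<noteq> 0"
  shows "Ck_on k U (\<lambda>x. inverse (f x))"
  using assms(2)
proof (induction k)
  case 0
  then show ?case using assms(3) by (auto intro: continuous_on_inverse)
next
  case (Suc k)
  have "Ck_on k U (\<lambda>x. inverse (f x))" using Suc.IH[OF Ck_on_Suc_imp[OF Suc.prems]] .
  then have "Ck_on k U (\<lambda>x. - (inverse (f x) * frechet_derivative f (at x) v * inverse (f x)))" for v
    using Suc.prems
    by (intro Ck_on_linear_compose[OF assms(1) bounded_linear_minus[OF bounded_linear_ident]]
        Ck_on_bilinear[OF assms(1) bounded_bilinear_mult]) auto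
  then show ?case
    by (intro Ck_on_SucI[OF assms(1) Deriv.has_derivative_inverse[OF assms(3) Ck_on_derivative[OF Suc.prems]]])
qed

lemma smooth_on_const: "open U \<Longrightarrow> smooth_on U (\<lambda>x. c)"
  by (simp add: smooth_on_def Ck_on_const)

lemma smooth_on_linear_compose:
  "open U \<Longrightarrow> bounded_linear L \<Longrightarrow> smooth_on U f \<Longrightarrow> smooth_on U (\<lambda>x. L (f x))"
  by (simp add: smooth_on_def Ck_on_linear_compose)

lemma smooth_on_linear:
  assumes "open U" "bounded_linear L" shows "smooth_on U L"
  unfolding smooth_on_def
proof
  fix k show "Ck_on k U L"
  proof (cases k)
    case 0
    then show ?thesis using assms(2) linear_continuous_on by simp
  next
    case (Suc j)
    have "Ck_on (Suc j) U L"
      by (rule Ck_on_SucI[OF assms(1) bounded_linear.has_derivative[OF assms(2) has_derivative_ident]])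
        (rule Ck_on_const[OF assms(1)])
    then show ?thesis using Suc by simp
  qed
qed

lemma smooth_on_add:
  "open U \<Longrightarrow> smooth_on U f \<Longrightarrow> smooth_on U g \<Longrightarrow> smooth_on U (\<lambda>x. f x + g x)"
  by (simp add: smooth_on_def Ck_on_add)

lemma smooth_on_sum:
  "open U \<Longrightarrow> (\<And>i. i \<in> I \<Longrightarrow> smooth_on U (f i)) \<Longrightarrow> smooth_on U (\<lambda>x. \<Sum>i\<in>I. f i x)"
  by (induction I rule: infinite_finite_induct) (auto intro: smooth_on_const smooth_on_add)

lemma smooth_on_bilinear:
  "open U \<Longrightarrow> bounded_bilinear mul \<Longrightarrow> smooth_on U f \<Longrightarrow> smooth_on U g
    \<Longrightarrow> smooth_on U (\<lambda>x. mul (f x) (g x))"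
  by (simp add: smooth_on_def Ck_on_bilinear)

lemmas smooth_on_mult = smooth_on_bilinear[OF _ bounded_bilinear_mult]
lemmas smooth_on_scaleR = smooth_on_bilinear[OF _ bounded_bilinear_scaleR]

lemma smooth_on_minus: "open U \<Longrightarrow> smooth_on U f \<Longrightarrow> smooth_on U (\<lambda>x. - f x)"
  by (rule smooth_on_linear_compose[OF _ bounded_linear_minus[OF bounded_linear_ident]])

lemma smooth_on_diff:
  assumes "open U" "smooth_on U f" "smooth_on U g" shows "smooth_on U (\<lambda>x. f x - g x)"
  using smooth_on_add[OF assms(1,2) smooth_on_minus[OF assms(1,3)]] by simp

lemma smooth_on_power:
  fixes f :: "'a::real_normed_vector \<Rightarrow> 'b::real_normed_field"
  shows "open U \<Longrightarrow> smooth_on U f \<Longrightarrow> smooth_on U (\<lambda>x. f x ^ n)"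
  by (induction n) (auto intro: smooth_on_const smooth_on_mult)

lemma smooth_on_divide:
  fixes f g :: "'a::real_normed_vector \<Rightarrow> complex"
  assumes "open U" "smooth_on U f" "smooth_on U g" "\<And>x. x \<in> U \<Longrightarrow> g x \<noteq> 0"
  shows "smooth_on U (\<lambda>x. f x / g x)"
  using assms unfolding divide_inverse
  by (intro smooth_on_mult) (auto simp: smooth_on_def Ck_on_inverse)

lemma smooth_on_imp_differentiable:
  assumes "smooth_on U f" "x \<in> U" shows "f differentiable (at x)"
proof -
  have "Ck_on (Suc 0) U f" using assms(1) unfolding smooth_on_def by blast
  then show ?thesis using assms(2) by simp
qed

lemma smooth_on_imp_continuous: "smooth_on U f \<Longrightarrow> continuous_on U f"
  unfolding smooth_on_def by (drule spec[where x = 0]) simp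

lemma smooth_on_subset:
  assumes "smooth_on U f" "V \<subseteq> U" shows "smooth_on V f"
proof -
  have "Ck_on k U g \<Longrightarrow> Ck_on k V g" for k and g :: "'a \<Rightarrow> 'b"
    using assms(2) by (induction k arbitrary: g) (auto intro: continuous_on_subset)
  then show ?thesis using assms(1) by (simp add: smooth_on_def)
qed

section \<open>Holomorphic forms transverse to the sphere\<close>

text \<open>
  The vectors \<open>ctan c z\<close> form the complex line in the tangent space of the sphere at \<open>z\<close>: they are
  the vectors orthogonal to \<open>z\<close> for the Hermitian product.
\<close>

definition ctan :: "complex \<Rightarrow> C2 \<Rightarrow> C2" where
  "ctan c z = (- (c * cnj (snd z)), c * cnj (fst z))"

lemma ctan_tangent: "ctan c z \<in> tangent z"
  by (simp add: ctan_def tangent_def inner_prod_def inner_complex_def algebra_simps)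

lemma ctan_eq: "ctan c z = Re c *\<^sub>R ctan 1 z + Im c *\<^sub>R ctan \<i> z"
  by (simp add: ctan_def complex_eq_iff)

lemma bounded_linear_ctan: "bounded_linear (ctan c)"
  by (rule linear_conv_bounded_linear[THEN iffD1], rule linearI)
    (auto simp: ctan_def algebra_simps)

lemma tangent_diff: "u \<in> tangent z \<Longrightarrow> v \<in> tangent z \<Longrightarrow> u - v \<in> tangent z"
  by (simp add: tangent_def inner_diff_left)

text \<open>
  Smoothness of a 1-form is defined by its values on constant vectors; expanding the vector in a
  basis gives the values on a vector that depends linearly on the point, such as \<open>ctan c x\<close>.
\<close>

lemma smooth_one_form_on_moving:
  assumes "open U" "smooth_one_form_on U \<Omega>" "bounded_linear L"
  shows "smooth_on U (\<lambda>x. \<Omega> x (L x))"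
proof -
  have "smooth_on U (\<lambda>x. (L x \<bullet> b) *\<^sub>R \<Omega> x b)" for b
    using assms(2) unfolding smooth_one_form_on_def
    by (intro smooth_on_scaleR[OF assms(1) smooth_on_linear[OF assms(1)
            bounded_linear_inner_left_comp[OF assms(3)]]]) blast
  then have "smooth_on U (\<lambda>x. \<Sum>b\<in>Basis. (L x \<bullet> b) *\<^sub>R \<Omega> x b)"
    by (rule smooth_on_sum[OF assms(1)])
  moreover have eq: "(\<Sum>b\<in>Basis. (L x \<bullet> b) *\<^sub>R \<Omega> x b) = \<Omega> x (L x)" if "x \<in> U" for x
  proof -
    have lin: "linear (\<Omega> x)" using assms(2) that by (auto simp: smooth_one_form_on_def)
    have "\<Omega> x (L x) = \<Omega> x (\<Sum>b\<in>Basis. (L x \<bullet> b) *\<^sub>R b)" by (simp add: euclidean_representation)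
    then show ?thesis by (simp add: linear_sum[OF lin] linear_scale[OF lin])
  qed
  ultimately show ?thesis
    unfolding smooth_on_def using Ck_on_cong[OF assms(1) eq] by simp
qed

text \<open>
  The form is \<open>\<Omega> = A dz\<^sub>1 + B dz\<^sub>2\<close>; the functions \<open>A1, A2, B1, B2\<close> are the complex partial derivatives of
  the coefficients. Its kernel is the complex line spanned by \<open>X = (B, -A)\<close>, and the last assumption
  says that this line is not the complex line in the tangent space of the sphere, hence that
  it meets the tangent space in a real line. Both families of the theorem are of this kind, with
  the leaves being the components of the intersections of the sphere with the complex orbits of \<open>X\<close>.
\<close>

locale transverse_holomorphic_form =
  fixes A B A1 A2 B1 B2 :: "C2 \<Rightarrow> complex"
  assumes dA: "(A has_derivative (\<lambda>u. A1 z * fst u + A2 z * snd u)) (at z)"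
    and dB: "(B has_derivative (\<lambda>u. B1 z * fst u + B2 z * snd u)) (at z)"
    and smooth_A: "smooth_on UNIV A"
    and smooth_B: "smooth_on UNIV B"
    and transverse: "z \<in> S3 \<Longrightarrow> B z * cnj (fst z) - A z * cnj (snd z) \<noteq> 0"
begin

definition form :: one_form where
  "form z v = A z * fst v + B z * snd v"

text \<open>
  The value of \<open>\<Omega>\<close> on the complex tangent vector \<open>ctan 1 z\<close>.
\<close>

definition W :: "C2 \<Rightarrow> complex" where
  "W z = B z * cnj (fst z) - A z * cnj (snd z)"

text \<open>
  The coefficient of \<open>d\<Omega> = D dz\<^sub>1 \<and> dz\<^sub>2\<close>. For a kernel vector \<open>T = \<rho> X\<close> one finds
  \<open>d\<Omega> (T, u) = \<rho> D \<Omega> u\<close>.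
\<close>

definition D :: "C2 \<Rightarrow> complex" where
  "D z = B1 z - A2 z"

lemma form_ctan: "form z (ctan c z) = c * W z"
  by (simp add: form_def ctan_def W_def algebra_simps)

lemma W_nonzero: "z \<in> S3 \<Longrightarrow> W z \<noteq> 0"
  unfolding W_def by (rule transverse)

lemma linear_form: "linear (form z)"
  by (rule linearI) (simp_all add: form_def algebra_simps scaleR_conv_of_real)

lemma smooth_form: "smooth_on UNIV (\<lambda>z. form z v)"
  unfolding form_def
  by (rule smooth_on_add[OF open_UNIV smooth_on_mult[OF open_UNIV smooth_A smooth_on_const[OF open_UNIV]]
        smooth_on_mult[OF open_UNIV smooth_B smooth_on_const[OF open_UNIV]]])

lemma smooth_W: "smooth_on UNIV W"
proof -
  have "smooth_on UNIV (\<lambda>z. cnj (fst z))" "smooth_on UNIV (\<lambda>z. cnj (snd z))"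
    by (rule smooth_on_linear[OF open_UNIV bounded_linear_compose[OF bounded_linear_cnj bounded_linear_fst]]
        smooth_on_linear[OF open_UNIV bounded_linear_compose[OF bounded_linear_cnj bounded_linear_snd]])+
  then show ?thesis
    unfolding W_def[abs_def]
    by (rule smooth_on_diff[OF open_UNIV smooth_on_mult[OF open_UNIV smooth_B]
          smooth_on_mult[OF open_UNIV smooth_A]])
qed

lemma has_derivative_form:
  "((\<lambda>z. form z v) has_derivative
    (\<lambda>u. (A1 z * fst u + A2 z * snd u) * fst v + (B1 z * fst u + B2 z * snd u) * snd v)) (at z)"
  unfolding form_def
  by (intro has_derivative_add has_derivative_mult_left dA dB)

lemma ext_deriv_form: "ext_deriv form z u v = D z * (fst u * snd v - snd u * fst v)"
  unfolding ext_deriv_def frechet_derivative_at[OF has_derivative_form, symmetric] D_def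
  by (simp add: algebra_simps)

lemma smooth_extension_form: "smooth_extension UNIV form (restrict_S3 form)"
  by (simp add: smooth_extension_def smooth_one_form_on_def linear_form smooth_form)

text \<open>
  A holomorphic 1-form in two variables has \<open>\<Omega> \<and> d\<Omega> = 0\<close> because there are no holomorphic
  3-forms; independence of the real and imaginary parts is the transversality assumption, tested
  on complex tangent vectors.
\<close>

lemma formally_integrable_form: "formally_integrable (restrict_S3 form)"
  unfolding formally_integrable_def
proof (intro conjI ballI allI impI)
  show "one_form_S3 (restrict_S3 form)"
    using smooth_extension_form one_form_S3_def by blast
next
  fix p u v w assume "p \<in> S3" "u \<in> tangent p" "v \<in> tangent p" "w \<in> tangent p"
  then show "wedge12 (restrict_S3 form p) (ext_deriv_S3 (restrict_S3 form) p) u v w = 0"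
    unfolding ext_deriv_S3_eq[OF smooth_extension_form]
    by (simp add: restrict2_S3_def restrict_S3_def wedge12_def ext_deriv_form form_def algebra_simps)
next
  fix p and s t :: real assume p: "p \<in> S3" and
    st: "\<forall>v\<in>tangent p. s * Re (restrict_S3 form p v) + t * Im (restrict_S3 form p v) = 0"
  have "s * Re (c * W p) + t * Im (c * W p) = 0" for c
    using bspec[OF st ctan_tangent[of c]] p by (simp add: restrict_S3_def ctan_tangent form_ctan)
  from this[of "1 / W p"] this[of "\<i> / W p"] show "s = 0" "t = 0"
    using W_nonzero[OF p] by simp_all
qed

text \<open>
  A real-linear function that vanishes on the kernel of \<open>\<Omega>\<close> factors through the value of \<open>\<Omega>\<close>, and
  real-linear functions of one complex variable are combinations of the identity and conjugation.
  The coefficients are found on \<open>ctan 1 z\<close> and \<open>ctan \<i> z\<close>, which together represent the normal plane.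
\<close>

lemma linear_on_tangent_decomposition:
  assumes z: "z \<in> S3" and g: "linear g"
    and ker: "\<And>v. v \<in> tangent z \<Longrightarrow> form z v = 0 \<Longrightarrow> g v = 0" and v: "v \<in> tangent z"
  shows "g v = (g (ctan 1 z) - \<i> * g (ctan \<i> z)) / (2 * W z) * form z v
             + (g (ctan 1 z) + \<i> * g (ctan \<i> z)) / (2 * cnj (W z)) * cnj (form z v)"
proof -
  \<comment> \<open>subtracting the complex tangent vector on which \<Omega> has the same value leaves a kernel vector\<close>
  define c where "c = form z v / W z"
  have c: "form z v = c * W z" using W_nonzero[OF z] by (simp add: c_def)
  have "g (v - ctan c z) = 0"
    by (intro ker tangent_diff v ctan_tangent) (simp add: linear_diff[OF linear_form] form_ctan c)
  then have "g v = g (ctan c z)" by (simp add: linear_diff[OF g])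
  also have "\<dots> = Re c * g (ctan 1 z) + Im c * g (ctan \<i> z)"
    by (subst ctan_eq) (simp add: linear_add[OF g] linear_scale[OF g] scaleR_conv_of_real)
  also have "\<dots> = (g (ctan 1 z) - \<i> * g (ctan \<i> z)) / 2 * c + (g (ctan 1 z) + \<i> * g (ctan \<i> z)) / 2 * cnj c"
  proof -
    have "(a - \<i> * b) / 2 * (x + \<i> * y) + (a + \<i> * b) / 2 * (x - \<i> * y) = x * a + y * b" for a b x y
      by (simp add: field_simps)
    moreover have "c = Re c + \<i> * Im c" "cnj c = Re c - \<i> * Im c" by (simp_all add: complex_eq_iff)
    ultimately show ?thesis by metis
  qed
  also have "\<dots> = (g (ctan 1 z) - \<i> * g (ctan \<i> z)) / (2 * W z) * form z v
             + (g (ctan 1 z) + \<i> * g (ctan \<i> z)) / (2 * cnj (W z)) * cnj (form z v)"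
    using W_nonzero[OF z] by (simp add: c)
  finally show ?thesis .
qed

definition mixed :: "(C2 \<Rightarrow> complex) \<Rightarrow> (C2 \<Rightarrow> complex) \<Rightarrow> one_form" where
  "mixed \<alpha> \<beta> z v = \<alpha> z * form z v + \<beta> z * cnj (form z v)"

text \<open>
  Cartan's formula in disguise: contracting \<open>d (\<alpha> \<Omega> + \<beta> \<Omega>\<^sup>*)\<close>, where \<open>\<Omega>\<^sup>*\<close> is the complex conjugate of
  \<open>\<Omega>\<close>, with a vector of the kernel leaves again a combination of \<open>\<Omega>\<close> and \<open>\<Omega>\<^sup>*\<close>.
\<close>

lemma ext_deriv_mixed_kernel:
  assumes a: "\<alpha> differentiable (at p)" and b: "\<beta> differentiable (at p)"
    and T: "T = (\<rho> * B p, - (\<rho> * A p))"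
  shows "ext_deriv (mixed \<alpha> \<beta>) p T u =
    (frechet_derivative \<alpha> (at p) T + \<alpha> p * (\<rho> * D p)) * form p u +
    (frechet_derivative \<beta> (at p) T + \<beta> p * cnj (\<rho> * D p)) * cnj (form p u)"
proof -
  note a' = frechet_derivative_works[THEN iffD1, OF a]
  note b' = frechet_derivative_works[THEN iffD1, OF b]
  let ?d = "\<lambda>u v. (A1 p * fst u + A2 p * snd u) * fst v + (B1 p * fst u + B2 p * snd u) * snd v"
  have d: "((\<lambda>z. mixed \<alpha> \<beta> z v) has_derivative
     (\<lambda>u. (\<alpha> p * ?d u v + frechet_derivative \<alpha> (at p) u * form p v) +
       (\<beta> p * cnj (?d u v) + frechet_derivative \<beta> (at p) u * cnj (form p v)))) (at p)" for v
    unfolding mixed_def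
    by (intro has_derivative_add has_derivative_mult a' b' has_derivative_form
        bounded_linear.has_derivative[OF bounded_linear_cnj])
  have T0: "form p T = 0" by (simp add: T form_def)
  have lam: "?d T u - ?d u T = \<rho> * D p * form p u"
    by (simp add: T form_def D_def algebra_simps)
  have "ext_deriv (mixed \<alpha> \<beta>) p T u =
      \<alpha> p * (?d T u - ?d u T) + frechet_derivative \<alpha> (at p) T * form p u +
      (\<beta> p * cnj (?d T u - ?d u T) + frechet_derivative \<beta> (at p) T * cnj (form p u))"
    unfolding ext_deriv_def frechet_derivative_at[OF d, symmetric] T0
    by (simp only: complex_cnj_diff) (simp add: algebra_simps)
  then show ?thesis unfolding lam by (simp add: algebra_simps)
qed

text \<open>
  Any form that defines the same foliation is a combination of \<open>\<Omega>\<close> and its conjugate on the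
  sphere, by the pointwise decomposition. The explicit coefficients are smooth near the sphere, so
  that the combination is a new smooth extension of the form, and its exterior derivative may be
  computed from it. The coorientation enters through \<open>\<alpha> \<noteq> 0\<close>: a multiple of the conjugate of
  \<open>\<Omega>\<close> would orient the normal planes the other way or degenerate.
\<close>

lemma defining_form_mixed:
  assumes int: "formally_integrable \<omega>'" and fol: "foliation_of \<omega>' = foliation_of (restrict_S3 form)"
  obtains U \<alpha> \<beta> where "smooth_on U \<alpha>" "smooth_on U \<beta>"
    "smooth_extension U (mixed \<alpha> \<beta>) \<omega>'" "\<And>p. p \<in> S3 \<Longrightarrow> \<alpha> p \<noteq> 0"
proof -
  obtain U0 \<Omega> where ext0: "smooth_extension U0 \<Omega> \<omega>'"
    using int by (auto simp: formally_integrable_def one_form_S3_def)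
  then have U0: "open U0" "S3 \<subseteq> U0" and sm: "smooth_one_form_on U0 \<Omega>" and \<omega>': "\<omega>' = restrict_S3 \<Omega>"
    by (auto simp: smooth_extension_def)
  define U where "U = U0 \<inter> {z. W z \<noteq> 0}"
  have "open {z. W z \<noteq> 0}"
    by (intro open_Collect_neq smooth_on_imp_continuous smooth_W continuous_on_const)
  then have U: "open U" "S3 \<subseteq> U" "U \<subseteq> U0" using U0 W_nonzero by (auto simp: U_def)
  have W0: "W z \<noteq> 0" if "z \<in> U" for z using that by (simp add: U_def)
  have smU: "smooth_one_form_on U \<Omega>"
    using sm U(3) smooth_on_subset[OF _ U(3)] unfolding smooth_one_form_on_def by blast
  have smW: "smooth_on U W" using smooth_on_subset[OF smooth_W] by simp
  define \<alpha> where "\<alpha> = (\<lambda>z. (\<Omega> z (ctan 1 z) - \<i> * \<Omega> z (ctan \<i> z)) / (2 * W z))"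
  define \<beta> where "\<beta> = (\<lambda>z. (\<Omega> z (ctan 1 z) + \<i> * \<Omega> z (ctan \<i> z)) / (2 * cnj (W z)))"
  note sV = smooth_one_form_on_moving[OF U(1) smU bounded_linear_ctan]
  note const = smooth_on_const[OF U(1)] and mult = smooth_on_mult[OF U(1)]
  have sa: "smooth_on U \<alpha>"
    unfolding \<alpha>_def
    by (rule smooth_on_divide[OF U(1) smooth_on_diff[OF U(1) sV mult[OF const sV]] mult[OF const smW]])
      (simp add: W0)
  have sb: "smooth_on U \<beta>"
    unfolding \<beta>_def
    by (rule smooth_on_divide[OF U(1) smooth_on_add[OF U(1) sV mult[OF const sV]]
          mult[OF const smooth_on_linear_compose[OF U(1) bounded_linear_cnj smW]]])
      (simp add: W0)
  have lin: "linear (mixed \<alpha> \<beta> z)" for z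
    by (rule linearI) (simp_all add: mixed_def linear_add[OF linear_form] linear_scale[OF linear_form]
        algebra_simps scaleR_conv_of_real)
  have sform: "smooth_on U (\<lambda>z. form z v)" for v
    using smooth_on_subset[OF smooth_form] by simp
  have smix: "smooth_on U (\<lambda>z. mixed \<alpha> \<beta> z v)" for v
    unfolding mixed_def
    by (intro smooth_on_add smooth_on_mult sa sb U(1) sform
        smooth_on_linear_compose[OF _ bounded_linear_cnj])
  have ker: "\<Omega> p v = 0" if "p \<in> S3" "v \<in> tangent p" "form p v = 0" for p v
  proof -
    have sets: "{v \<in> tangent p. Re (\<omega>' p v) = 0} \<inter> {v \<in> tangent p. Im (\<omega>' p v) = 0} =
      {v \<in> tangent p. Re (restrict_S3 form p v) = 0} \<inter> {v \<in> tangent p. Im (restrict_S3 form p v) = 0}"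
      using fun_cong[OF fol, of p] that(1) by (simp add: foliation_of_def)
    have "restrict_S3 form p v = 0" using that by (simp add: restrict_S3_def)
    then have "v \<in> {v \<in> tangent p. Re (restrict_S3 form p v) = 0} \<inter>
        {v \<in> tangent p. Im (restrict_S3 form p v) = 0}"
      using that(2) by simp
    then have "\<omega>' p v = 0" unfolding sets[symmetric] by (simp add: complex_eq_iff)
    then show ?thesis using that(1,2) by (simp add: \<omega>' restrict_S3_def)
  qed
  have mix: "\<Omega> p v = mixed \<alpha> \<beta> p v" if "p \<in> S3" "v \<in> tangent p" for p v
  proof -
    have "linear (\<Omega> p)" using sm U0(2) that(1) unfolding smooth_one_form_on_def by blast
    from linear_on_tangent_decomposition[OF that(1) this ker[OF that(1)] that(2)]
    show ?thesis unfolding mixed_def \<alpha>_def \<beta>_def .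
  qed
  have "\<omega>' = restrict_S3 (mixed \<alpha> \<beta>)"
    unfolding \<omega>' restrict_S3_def by (intro ext) (simp add: mix)
  then have ext': "smooth_extension U (mixed \<alpha> \<beta>) \<omega>'"
    using U(1,2) lin smix unfolding smooth_extension_def smooth_one_form_on_def by blast
  have a0: "\<alpha> p \<noteq> 0" if p: "p \<in> S3" for p
  proof
    assume "\<alpha> p = 0"
    have t: "ctan 1 p \<in> tangent p" "ctan \<i> p \<in> tangent p" by (rule ctan_tangent)+
    have "{(u, v). u \<in> tangent p \<and> v \<in> tangent p \<and> wedge_Re_Im (\<omega>' p) u v > 0} =
      {(u, v). u \<in> tangent p \<and> v \<in> tangent p \<and> wedge_Re_Im (restrict_S3 form p) u v > 0}"
      using fun_cong[OF fol, of p] p by (simp add: foliation_of_def)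
    then have iff: "wedge_Re_Im (\<omega>' p) (ctan 1 p) (ctan \<i> p) > 0 \<longleftrightarrow>
        wedge_Re_Im (restrict_S3 form p) (ctan 1 p) (ctan \<i> p) > 0"
      using t by blast
    have "wedge_Re_Im (restrict_S3 form p) (ctan 1 p) (ctan \<i> p) = (Re (W p))\<^sup>2 + (Im (W p))\<^sup>2"
      using p t by (simp add: wedge_Re_Im_def restrict_S3_def form_ctan power2_eq_square)
    moreover have "\<dots> > 0" using W_nonzero[OF p] by (simp add: complex_neq_0)
    moreover define b where "b = \<beta> p * cnj (W p)"
    have "\<omega>' p (ctan 1 p) = b" "\<omega>' p (ctan \<i> p) = - \<i> * b"
      using p t by (simp_all add: \<omega>' restrict_S3_def mix mixed_def \<open>\<alpha> p = 0\<close> form_ctan b_def)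
    then have "wedge_Re_Im (\<omega>' p) (ctan 1 p) (ctan \<i> p) = - ((Re b)\<^sup>2 + (Im b)\<^sup>2)"
      by (simp add: wedge_Re_Im_def power2_eq_square)
    moreover have "(Re b)\<^sup>2 + (Im b)\<^sup>2 \<ge> 0" by simp
    ultimately show False using iff by (metis neg_le_0_iff_le not_less)
  qed
  show thesis by (rule that[OF sa sb ext' a0])
qed

text \<open>
  The integrability condition \<open>\<omega>' \<and> d\<omega>' = 0\<close>, evaluated on a vector of the foliation and the two
  complex tangent vectors, is an equation for the logarithmic derivative of \<open>\<mu> = \<beta> / \<alpha>\<close> along the
  leaves: \<open>d\<mu> (T) = \<mu> (\<rho> D - cnj (\<rho> D))\<close>.
\<close>

lemma beltrami_equation:
  assumes int: "formally_integrable \<omega>'" and ext: "smooth_extension U (mixed \<alpha> \<beta>) \<omega>'"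
    and sa: "smooth_on U \<alpha>" and sb: "smooth_on U \<beta>"
    and p: "p \<in> S3" and T: "T = (\<rho> * B p, - (\<rho> * A p))" "T \<in> tangent p"
  shows "\<alpha> p * frechet_derivative \<beta> (at p) T - \<beta> p * frechet_derivative \<alpha> (at p) T
       = \<alpha> p * \<beta> p * (\<rho> * D p - cnj (\<rho> * D p))"
proof -
  have U: "p \<in> U" and \<omega>': "\<omega>' = restrict_S3 (mixed \<alpha> \<beta>)"
    using ext p by (auto simp: smooth_extension_def)
  let ?u = "ctan 1 p" and ?v = "ctan \<i> p"
  have t: "?u \<in> tangent p" "?v \<in> tangent p" by (rule ctan_tangent)+
  define P where "P = frechet_derivative \<alpha> (at p) T + \<alpha> p * (\<rho> * D p)"
  define Q where "Q = frechet_derivative \<beta> (at p) T + \<beta> p * cnj (\<rho> * D p)"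
  have ed: "ext_deriv (mixed \<alpha> \<beta>) p T u = P * form p u + Q * cnj (form p u)" for u
    unfolding P_def Q_def
    by (rule ext_deriv_mixed_kernel[OF smooth_on_imp_differentiable[OF sa U]
          smooth_on_imp_differentiable[OF sb U] T(1)])
  have anti: "ext_deriv (mixed \<alpha> \<beta>) p ?v T = - ext_deriv (mixed \<alpha> \<beta>) p T ?v"
    by (simp add: ext_deriv_def)
  have T0: "form p T = 0" by (simp add: T(1) form_def)
  have "wedge12 (\<omega>' p) (ext_deriv_S3 \<omega>' p) ?u ?v T = 0"
    using int p t T(2) by (simp add: formally_integrable_def)
  then have "mixed \<alpha> \<beta> p ?u * ext_deriv (mixed \<alpha> \<beta>) p ?v T +
      mixed \<alpha> \<beta> p ?v * ext_deriv (mixed \<alpha> \<beta>) p T ?u + mixed \<alpha> \<beta> p T * ext_deriv (mixed \<alpha> \<beta>) p ?u ?v = 0"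
    unfolding ext_deriv_S3_eq[OF ext] wedge12_def
    using p t T(2) by (simp add: \<omega>' restrict_S3_def restrict2_S3_def)
  then have "2 * \<i> * (W p * cnj (W p)) * (\<alpha> p * Q - \<beta> p * P) = 0"
    unfolding anti ed mixed_def T0 form_ctan by (simp add: algebra_simps)
  then have "\<alpha> p * Q - \<beta> p * P = 0" using W_nonzero[OF p] by simp
  then show ?thesis by (simp add: P_def Q_def algebra_simps)
qed

end

section \<open>Beltrami coefficients are constant along leaves\<close>

lemma smooth_S3_divide:
  assumes "smooth_S3 f" "smooth_S3 g" "\<And>p. p \<in> S3 \<Longrightarrow> g p \<noteq> 0"
  shows "smooth_S3 (\<lambda>p. f p / g p)"
proof -
  obtain U H where H: "open U" "S3 \<subseteq> U" "smooth_on U H" "\<forall>p\<in>S3. f p = H p"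
    using assms(1) by (auto simp: smooth_S3_def)
  obtain V G where G: "open V" "S3 \<subseteq> V" "smooth_on V G" "\<forall>p\<in>S3. g p = G p"
    using assms(2) by (auto simp: smooth_S3_def)
  define N where "N = U \<inter> (V \<inter> G -` (- {0}))"
  have "open (V \<inter> G -` (- {0}))"
    by (rule continuous_open_preimage[OF smooth_on_imp_continuous[OF G(3)] G(1)]) auto
  then have N: "open N" "S3 \<subseteq> N" "N \<subseteq> U" "N \<subseteq> V" "\<And>x. x \<in> N \<Longrightarrow> G x \<noteq> 0"
    using H(1,2) G(2,4) assms(3) by (auto simp: N_def)
  have "smooth_on N (\<lambda>p. H p / G p)"
    by (rule smooth_on_divide[OF N(1) smooth_on_subset[OF H(3) N(3)] smooth_on_subset[OF G(3) N(4)] N(5)])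
  then show ?thesis
    unfolding smooth_S3_def using N(1,2) H(4) G(4) by (intro exI[of _ N] exI) auto
qed

text \<open>
  If all defining forms are multiples of one of them then any two are multiples of each other, so
  that there is just one equivalence class.
\<close>

lemma unique_transverse_holomorphic_structure:
  assumes int: "formally_integrable \<omega>"
    and mult: "\<And>\<omega>'. formally_integrable \<omega>' \<Longrightarrow> foliation_of \<omega>' = foliation_of \<omega> \<Longrightarrow>
      \<exists>h. smooth_S3 h \<and> (\<forall>p\<in>S3. h p \<noteq> 0) \<and> \<omega>' = (\<lambda>p v. h p * \<omega> p v)"
  shows "\<exists>!T. T \<in> transverse_holomorphic_structures (foliation_of \<omega>)"
proof -
  let ?S = "defining_forms (foliation_of \<omega>)"
  have outside: "\<omega> p v = 0" if "p \<notin> S3" for p v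
    using int that
    by (auto simp: formally_integrable_def one_form_S3_def smooth_extension_def restrict_S3_def)
  have "smooth_multiple \<omega>1 \<omega>2" if in_S: "\<omega>1 \<in> ?S" "\<omega>2 \<in> ?S" for \<omega>1 \<omega>2
  proof -
    obtain h where h: "smooth_S3 h" "\<forall>p\<in>S3. h p \<noteq> 0" "\<omega>1 = (\<lambda>p v. h p * \<omega> p v)"
      using mult[of \<omega>1] in_S(1) unfolding defining_forms_def by blast
    obtain g where g: "smooth_S3 g" "\<forall>p\<in>S3. g p \<noteq> 0" "\<omega>2 = (\<lambda>p v. g p * \<omega> p v)"
      using mult[of \<omega>2] in_S(2) unfolding defining_forms_def by blast
    have "g p * \<omega> p v = g p / h p * (h p * \<omega> p v)" for p v
      using h(2) outside[of p v] by (cases "p \<in> S3") auto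
    then show ?thesis
      unfolding smooth_multiple_def using h(2) g(2) smooth_S3_divide[OF g(1) h(1)]
      by (intro exI[of _ "\<lambda>p. g p / h p"]) (simp add: h(3) g(3))
  qed
  then have "transverse_holomorphic_structures (foliation_of \<omega>) = (\<lambda>x. ?S) ` ?S"
    unfolding transverse_holomorphic_structures_def quotient_def by blast
  moreover have "\<omega> \<in> ?S" using int by (simp add: defining_forms_def)
  ultimately have "transverse_holomorphic_structures (foliation_of \<omega>) = {?S}" by blast
  then show ?thesis by simp
qed

lemma S3_curve_tangent:
  assumes "open I" "t \<in> I" and "\<And>s. s \<in> I \<Longrightarrow> \<gamma> s \<in> S3"
    and d: "(\<gamma> has_vector_derivative T) (at t)"
  shows "T \<in> tangent (\<gamma> t)"
proof -
  have "((\<lambda>s. \<gamma> s \<bullet> \<gamma> s) has_derivative (\<lambda>h. \<gamma> t \<bullet> (h *\<^sub>R T) + (h *\<^sub>R T) \<bullet> \<gamma> t)) (at t)"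
    using d unfolding has_vector_derivative_def by (intro has_derivative_inner)
  moreover have "((\<lambda>s. \<gamma> s \<bullet> \<gamma> s) has_derivative (\<lambda>h. 0)) (at t)"
    using assms(3)
    by (intro has_derivative_transform_within_open[OF has_derivative_const[of 1] assms(1,2)])
      (auto simp: S3_def dot_square_norm)
  ultimately have "(\<lambda>h. \<gamma> t \<bullet> (h *\<^sub>R T) + (h *\<^sub>R T) \<bullet> \<gamma> t) = (\<lambda>h. 0)"
    by (rule has_derivative_unique)
  from fun_cong[OF this, of 1] show ?thesis by (simp add: tangent_def inner_commute)
qed

lemma has_vector_derivative_divide_complex:
  fixes N M :: "real \<Rightarrow> complex"
  assumes "(N has_vector_derivative N') (at t)" "(M has_vector_derivative M') (at t)" "M t \<noteq> 0"
  shows "((\<lambda>s. N s / M s) has_vector_derivative (N' * M t - N t * M') / (M t * M t)) (at t)"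
proof -
  have "((\<lambda>s. N s / M s) has_derivative
      (\<lambda>h. (h *\<^sub>R N' * M t - N t * (h *\<^sub>R M')) / (M t * M t))) (at t)"
    using assms unfolding has_vector_derivative_def by (intro has_derivative_divide') auto
  moreover have "(\<lambda>h. (h *\<^sub>R N' * M t - N t * (h *\<^sub>R M')) / (M t * M t)) =
      (\<lambda>h. h *\<^sub>R ((N' * M t - N t * M') / (M t * M t)))"
    by (simp add: fun_eq_iff scaleR_conv_of_real algebra_simps)
  ultimately show ?thesis by (simp add: has_vector_derivative_def)
qed

context transverse_holomorphic_form
begin

text \<open>
  A curve in a leaf, together with a solution \<open>F\<close> of the differential equation \<open>dF (T) = \<rho> D F\<close> along the
  curve. In the applications \<open>F\<close> comes from a holomorphic function \<open>f\<close> for which \<open>\<Omega> / f\<close> is closed. The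
  differential equations are required in the interior only, because one of the curves used later
  is merely continuous at an end point.
\<close>

definition leaf_curve :: "real \<Rightarrow> real \<Rightarrow> (real \<Rightarrow> C2) \<Rightarrow> (real \<Rightarrow> complex) \<Rightarrow> bool" where
  "leaf_curve a b \<gamma> F \<longleftrightarrow>
     continuous_on {a..b} \<gamma> \<and> continuous_on {a..b} F \<and>
     (\<forall>t\<in>{a..b}. \<gamma> t \<in> S3 \<and> F t \<noteq> 0) \<and>
     (\<forall>t\<in>{a<..<b}. \<exists>\<rho>.
        (\<gamma> has_vector_derivative (\<rho> * B (\<gamma> t), - (\<rho> * A (\<gamma> t)))) (at t) \<and>
        (F has_vector_derivative \<rho> * D (\<gamma> t) * F t) (at t))"

text \<open>
  The property shared by the Beltrami coefficients of all defining forms. Where \<open>\<Omega> / f\<close> is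
  closed and \<open>f\<close> has no zeros, \<open>\<Omega> + \<mu> \<Omega>\<^sup>*\<close> is \<open>f\<close> times the sum of \<open>\<Omega> / f\<close> and \<open>\<nu>\<close> times its conjugate, with
  \<open>\<nu> = \<mu> f\<^sup>* / f\<close>; it is \<open>\<nu>\<close>, not \<open>\<mu>\<close>, that is constant on the leaves.
\<close>

definition leafwise_constant :: "(C2 \<Rightarrow> complex) \<Rightarrow> bool" where
  "leafwise_constant \<mu> \<longleftrightarrow>
     continuous_on S3 \<mu> \<and>
     (\<forall>a b \<gamma> F. a \<le> b \<longrightarrow> leaf_curve a b \<gamma> F \<longrightarrow>
        \<mu> (\<gamma> a) * (cnj (F a) / F a) = \<mu> (\<gamma> b) * (cnj (F b) / F b))"

lemma leafwise_constant_quotient: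
  assumes int: "formally_integrable \<omega>'" and ext: "smooth_extension U (mixed \<alpha> \<beta>) \<omega>'"
    and sa: "smooth_on U \<alpha>" and sb: "smooth_on U \<beta>" and a0: "\<And>p. p \<in> S3 \<Longrightarrow> \<alpha> p \<noteq> 0"
  shows "leafwise_constant (\<lambda>p. \<beta> p / \<alpha> p)"
  unfolding leafwise_constant_def
proof (intro conjI allI impI)
  have U: "S3 \<subseteq> U" using ext by (simp add: smooth_extension_def)
  have ca: "continuous_on S3 \<alpha>" and cb: "continuous_on S3 \<beta>"
    using sa sb U continuous_on_subset smooth_on_imp_continuous by blast+
  then show cont: "continuous_on S3 (\<lambda>p. \<beta> p / \<alpha> p)"
    by (intro continuous_on_divide ballI a0)
  fix a b \<gamma> F assume "a \<le> b" and leaf: "leaf_curve a b \<gamma> F"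
  then have c\<gamma>: "continuous_on {a..b} \<gamma>" and cF: "continuous_on {a..b} F"
    and S: "\<And>t. t \<in> {a..b} \<Longrightarrow> \<gamma> t \<in> S3" and F0: "\<And>t. t \<in> {a..b} \<Longrightarrow> F t \<noteq> 0"
    by (auto simp: leaf_curve_def)
  define N where "N = (\<lambda>t. \<beta> (\<gamma> t) * cnj (F t))"
  define M where "M = (\<lambda>t. \<alpha> (\<gamma> t) * F t)"
  have M0: "M t \<noteq> 0" if "t \<in> {a..b}" for t
    using a0 S F0 that by (simp add: M_def)
  have der0: "((\<lambda>s. N s / M s) has_derivative (\<lambda>h. 0)) (at t)" if t: "t \<in> {a<..<b}" for t
  proof -
    obtain \<rho> where d\<gamma>: "(\<gamma> has_vector_derivative (\<rho> * B (\<gamma> t), - (\<rho> * A (\<gamma> t)))) (at t)"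
      and dF: "(F has_vector_derivative \<rho> * D (\<gamma> t) * F t) (at t)"
      using leaf t unfolding leaf_curve_def by blast
    define T where "T = (\<rho> * B (\<gamma> t), - (\<rho> * A (\<gamma> t)))"
    have t': "t \<in> {a..b}" using t by simp
    have T: "T \<in> tangent (\<gamma> t)"
      unfolding T_def by (rule S3_curve_tangent[OF _ t _ d\<gamma>]) (auto intro: S)
    have p: "\<gamma> t \<in> S3" "\<gamma> t \<in> U" using S[OF t'] U by auto
    have chain: "((\<lambda>s. f (\<gamma> s)) has_vector_derivative frechet_derivative f (at (\<gamma> t)) T) (at t)"
      if "smooth_on U f" for f :: "C2 \<Rightarrow> complex"
      using vector_derivative_diff_chain_within[OF d\<gamma> has_derivative_at_withinI[OF
            frechet_derivative_works[THEN iffD1, OF smooth_on_imp_differentiable[OF that p(2)]]]]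
      by (simp add: T_def o_def)
    define l where "l = \<rho> * D (\<gamma> t)"
    define \<alpha>' where "\<alpha>' = frechet_derivative \<alpha> (at (\<gamma> t)) T"
    define \<beta>' where "\<beta>' = frechet_derivative \<beta> (at (\<gamma> t)) T"
    have dcF: "((\<lambda>s. cnj (F s)) has_vector_derivative cnj (l * F t)) (at t)"
      using dF unfolding l_def by (rule bounded_linear.has_vector_derivative[OF bounded_linear_cnj])
    have dN: "(N has_vector_derivative \<beta> (\<gamma> t) * cnj (l * F t) + \<beta>' * cnj (F t)) (at t)"
      unfolding N_def \<beta>'_def by (rule has_vector_derivative_mult[OF chain[OF sb] dcF])
    have dM: "(M has_vector_derivative \<alpha> (\<gamma> t) * (l * F t) + \<alpha>' * F t) (at t)"
      unfolding M_def \<alpha>'_def using has_vector_derivative_mult[OF chain[OF sa] dF]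
      by (simp add: l_def)
    \<comment> \<open>the numerator of the derivative of N / M is a multiple of the Beltrami equation\<close>
    have "\<alpha> (\<gamma> t) * \<beta>' - \<beta> (\<gamma> t) * \<alpha>' = \<alpha> (\<gamma> t) * \<beta> (\<gamma> t) * (l - cnj l)"
      unfolding \<alpha>'_def \<beta>'_def l_def by (rule beltrami_equation[OF int ext sa sb p(1) T_def T])
    moreover have "(\<beta> (\<gamma> t) * cnj (l * F t) + \<beta>' * cnj (F t)) * M t
        - N t * (\<alpha> (\<gamma> t) * (l * F t) + \<alpha>' * F t)
      = (F t * cnj (F t)) * ((\<alpha> (\<gamma> t) * \<beta>' - \<beta> (\<gamma> t) * \<alpha>') - \<alpha> (\<gamma> t) * \<beta> (\<gamma> t) * (l - cnj l))"
      by (simp add: N_def M_def algebra_simps)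
    ultimately have "(\<beta> (\<gamma> t) * cnj (l * F t) + \<beta>' * cnj (F t)) * M t
        - N t * (\<alpha> (\<gamma> t) * (l * F t) + \<alpha>' * F t) = 0" by simp
    with has_vector_derivative_divide_complex[OF dN dM M0[OF t']]
    show ?thesis by (simp add: has_vector_derivative_def)
  qed
  have der: "((\<lambda>s. N s / M s) has_derivative (\<lambda>h. 0)) (at t within {a..b})"
    if "t \<in> {a..b} - {a, b}" for t
    by (rule has_derivative_at_withinI[OF der0]) (use that in simp)
  have comp: "continuous_on {a..b} (\<lambda>s. f (\<gamma> s))" if "continuous_on S3 f" for f :: "C2 \<Rightarrow> complex"
    by (rule continuous_on_compose2[OF that c\<gamma>]) (use S in auto)
  have "continuous_on {a..b} N" "continuous_on {a..b} M"
    unfolding N_def M_def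
    by (rule continuous_on_mult[OF comp[OF cb] continuous_on_cnj[OF cF]]
        continuous_on_mult[OF comp[OF ca] cF])+
  then have "continuous_on {a..b} (\<lambda>s. N s / M s)"
    using M0 by (intro continuous_on_divide) auto
  from has_derivative_zero_unique_strong_interval[OF _ this refl, of "{a, b}" b] der \<open>a \<le> b\<close>
  have "N b / M b = N a / M a" by simp
  then show "\<beta> (\<gamma> a) / \<alpha> (\<gamma> a) * (cnj (F a) / F a) = \<beta> (\<gamma> b) / \<alpha> (\<gamma> b) * (cnj (F b) / F b)"
    by (simp add: N_def M_def)
qed

text \<open>
  A defining form with Beltrami coefficient \<open>0\<close> is \<open>\<alpha> \<Omega>\<close>; it remains to exclude all other leafwise
  constant functions, which is where the dynamics of the foliation matters.
\<close>

lemma rigidity: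
  assumes vanish: "\<And>\<mu> p. leafwise_constant \<mu> \<Longrightarrow> p \<in> S3 \<Longrightarrow> \<mu> p = 0"
    and int: "formally_integrable \<omega>'" and fol: "foliation_of \<omega>' = foliation_of (restrict_S3 form)"
  shows "\<exists>h. smooth_S3 h \<and> (\<forall>p\<in>S3. h p \<noteq> 0) \<and> \<omega>' = (\<lambda>p v. h p * restrict_S3 form p v)"
proof -
  obtain U \<alpha> \<beta> where *: "smooth_on U \<alpha>" "smooth_on U \<beta>"
    "smooth_extension U (mixed \<alpha> \<beta>) \<omega>'" "\<And>p. p \<in> S3 \<Longrightarrow> \<alpha> p \<noteq> 0"
    using defining_form_mixed[OF int fol] by blast
  have "\<beta> p = 0" if "p \<in> S3" for p
    using vanish[OF leafwise_constant_quotient[OF int *(3,1,2,4)] that] *(4)[OF that] by simp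
  moreover have U: "open U" "S3 \<subseteq> U" "\<omega>' = restrict_S3 (mixed \<alpha> \<beta>)"
    using *(3) by (auto simp: smooth_extension_def)
  ultimately have "\<omega>' = (\<lambda>p v. \<alpha> p * restrict_S3 form p v)"
    unfolding U(3) restrict_S3_def mixed_def by (intro ext) simp
  then show ?thesis
    using U(1,2) *(1,4) unfolding smooth_S3_def by blast
qed

theorem unique_structure:
  assumes vanish: "\<And>\<mu> p. leafwise_constant \<mu> \<Longrightarrow> p \<in> S3 \<Longrightarrow> \<mu> p = 0"
  shows "formally_integrable (restrict_S3 form) \<and>
    (\<exists>!T. T \<in> transverse_holomorphic_structures (foliation_of (restrict_S3 form))) \<and>
    (\<forall>\<omega>'. formally_integrable \<omega>' \<and> foliation_of \<omega>' = foliation_of (restrict_S3 form) \<longrightarrow>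
      (\<exists>h. smooth_S3 h \<and> (\<forall>p\<in>S3. h p \<noteq> 0) \<and> \<omega>' = (\<lambda>p v. h p * restrict_S3 form p v)))"
proof -
  have "\<exists>h. smooth_S3 h \<and> (\<forall>p\<in>S3. h p \<noteq> 0) \<and> \<omega>' = (\<lambda>p v. h p * restrict_S3 form p v)"
    if "formally_integrable \<omega>'" "foliation_of \<omega>' = foliation_of (restrict_S3 form)" for \<omega>'
    using vanish that by (rule rigidity)
  then show ?thesis
    using formally_integrable_form unique_transverse_holomorphic_structure[OF formally_integrable_form]
    by blast
qed

end

section \<open>Limits along leaves\<close>

lemma has_vector_derivative_exp_compose:
  fixes L :: "real \<Rightarrow> complex"
  assumes "(L has_vector_derivative l) (at t)"
  shows "((\<lambda>s. exp (L s)) has_vector_derivative l * exp (L t)) (at t)"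
  using field_vector_diff_chain_at[OF assms DERIV_exp] by (simp add: o_def)

lemma cnj_exp_quotient: "cnj (exp z) / exp z = cis (- 2 * Im z)"
proof -
  have "cnj (exp z) / exp z = exp (cnj z - z)" by (simp add: exp_cnj exp_diff)
  also have "cnj z - z = \<i> * of_real (- 2 * Im z)" by (simp add: complex_eq_iff)
  finally show ?thesis by (simp add: cis_conv_exp)
qed

lemma S3_iff: "p \<in> S3 \<longleftrightarrow> (norm (fst p))\<^sup>2 + (norm (snd p))\<^sup>2 = 1"
  by (cases p) (simp add: S3_def norm_Pair)

text \<open>
  Used with the argument of a coordinate along an end of a leaf: the argument tends to
  infinity, hence runs through the multiples of a full turn at points that escape along the end.
\<close>

lemma level_sequence:
  fixes g :: "real \<Rightarrow> real"
  assumes cont: "continuous_on {..c} g" and lim: "filterlim g at_top at_bot" and P: "P > 0"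
  obtains t :: "nat \<Rightarrow> real" where "filterlim t at_bot sequentially"
    "eventually (\<lambda>k. t k \<le> c \<and> g (t k) = P * real k) sequentially"
proof -
  have ex: "\<exists>s\<le>c. g s = y" if "g c \<le> y" for y
  proof -
    obtain N where N: "\<And>s. s \<le> N \<Longrightarrow> y \<le> g s"
      using filterlim_at_top[THEN iffD1, OF lim] unfolding eventually_at_bot_linorder by blast
    have "continuous_on {min N c..c} g" by (rule continuous_on_subset[OF cont]) auto
    from IVT2'[of g c y "min N c", OF that _ _ this] N[of "min N c"] show ?thesis by auto
  qed
  define t where "t = (\<lambda>k. SOME s. s \<le> c \<and> g s = P * real k)"
  have Pk: "filterlim (\<lambda>k. P * real k) at_top sequentially"
    by (rule filterlim_tendsto_pos_mult_at_top[OF tendsto_const P filterlim_real_sequentially])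
  have t: "t k \<le> c \<and> g (t k) = P * real k" if "g c \<le> P * real k" for k
    unfolding t_def using ex[OF that] by (rule someI_ex[of "\<lambda>s. s \<le> c \<and> g s = P * real k"])
  have ev: "eventually (\<lambda>k. t k \<le> c \<and> g (t k) = P * real k) sequentially"
    using filterlim_at_top[THEN iffD1, OF Pk, rule_format, of "g c"] by eventually_elim (rule t)
  have "filterlim t at_bot sequentially"
    unfolding filterlim_at_bot
  proof
    fix Z
    have "continuous_on {min Z c..c} g" by (rule continuous_on_subset[OF cont]) auto
    then obtain r where M: "\<And>s. s \<in> {min Z c..c} \<Longrightarrow> g s \<le> g r"
      using continuous_attains_sup[of "{min Z c..c}" g] by (auto simp del: atLeastAtMost_iff)
    show "eventually (\<lambda>k. t k \<le> Z) sequentially"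
      using ev filterlim_at_top_dense[THEN iffD1, OF Pk, rule_format, of "g r"]
    proof eventually_elim
      case (elim k)
      then have "\<not> t k \<in> {min Z c..c}" using M[of "t k"] by auto
      then show ?case using elim by auto
    qed
  qed
  then show thesis using ev by (rule that)
qed

text \<open>
  The two circles \<open>z\<^sub>1 = 0\<close> and \<open>z\<^sub>2 = 0\<close> have empty interior in the sphere.
\<close>

lemma vanish_on_S3_if_vanish_off_axes:
  fixes \<mu> :: "C2 \<Rightarrow> complex"
  assumes cont: "continuous_on S3 \<mu>" and p: "p \<in> S3"
    and off: "\<And>q. q \<in> S3 \<Longrightarrow> fst q \<noteq> 0 \<Longrightarrow> snd q \<noteq> 0 \<Longrightarrow> \<mu> q = 0"
  shows "\<mu> p = 0"
proof -
  have *: "\<mu> p = 0"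
    if "(q \<longlongrightarrow> p) (at_right 0)" "\<And>x. x \<in> {0<..<1} \<Longrightarrow> q x \<in> S3 \<and> fst (q x) \<noteq> 0 \<and> snd (q x) \<noteq> 0"
    for q :: "real \<Rightarrow> C2"
  proof -
    have ev: "eventually (\<lambda>x. x \<in> {0<..<1}) (at_right (0::real))"
      by (rule eventually_at_rightI) auto
    then have "((\<lambda>x. \<mu> (q x)) \<longlongrightarrow> \<mu> p) (at_right 0)"
      using that(2) by (intro continuous_on_tendsto_compose[OF cont that(1) p]) (auto elim: eventually_mono)
    moreover have "((\<lambda>x. \<mu> (q x)) \<longlongrightarrow> 0) (at_right 0)"
      by (rule tendsto_eventually, rule eventually_mono[OF ev]) (use that(2) off in blast)
    ultimately show ?thesis by (rule tendsto_unique[rotated]) simp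
  qed
  have trig: "cos x > 0" "sin x > 0" if "x \<in> {0<..<1}" for x :: real
    using that pi_gt3 by (auto intro!: cos_gt_zero sin_gt_zero)
  have S: "(norm (fst p))\<^sup>2 + (norm (snd p))\<^sup>2 = 1" using p S3_iff by simp
  consider "snd p = 0" | "fst p = 0" | "fst p \<noteq> 0" "snd p \<noteq> 0" by blast
  then show ?thesis
  proof cases
    case 1
    then have n: "norm (fst p) = 1" using S norm_ge_zero[of "fst p"]
      by (auto simp: power2_eq_1_iff simp del: norm_ge_zero)
    then have f0: "fst p \<noteq> 0" by auto
    show ?thesis
    proof (rule *)
      have "((\<lambda>x. (of_real (cos x) * fst p, complex_of_real (sin x))) \<longlongrightarrow>
          (of_real (cos 0) * fst p, of_real (sin 0))) (at_right 0)"
        by (intro tendsto_intros)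
      then show "((\<lambda>x. (of_real (cos x) * fst p, complex_of_real (sin x))) \<longlongrightarrow> p) (at_right 0)"
        using 1 by (cases p) simp
      show "(of_real (cos x) * fst p, complex_of_real (sin x)) \<in> S3 \<and>
          fst (of_real (cos x) * fst p, complex_of_real (sin x)) \<noteq> 0 \<and>
          snd (of_real (cos x) * fst p, complex_of_real (sin x)) \<noteq> 0" if "x \<in> {0<..<1}" for x
        using trig[OF that] f0 n by (simp add: S3_iff norm_mult)
    qed
  next
    case 2
    then have n: "norm (snd p) = 1" using S norm_ge_zero[of "snd p"]
      by (auto simp: power2_eq_1_iff simp del: norm_ge_zero)
    then have f0: "snd p \<noteq> 0" by auto
    show ?thesis
    proof (rule *)
      have "((\<lambda>x. (complex_of_real (sin x), of_real (cos x) * snd p)) \<longlongrightarrow>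
          (of_real (sin 0), of_real (cos 0) * snd p)) (at_right 0)"
        by (intro tendsto_intros)
      then show "((\<lambda>x. (complex_of_real (sin x), of_real (cos x) * snd p)) \<longlongrightarrow> p) (at_right 0)"
        using 2 by (cases p) simp
      show "(complex_of_real (sin x), of_real (cos x) * snd p) \<in> S3 \<and>
          fst (complex_of_real (sin x), of_real (cos x) * snd p) \<noteq> 0 \<and>
          snd (complex_of_real (sin x), of_real (cos x) * snd p) \<noteq> 0" if "x \<in> {0<..<1}" for x
        using trig[OF that] f0 n by (simp add: S3_iff norm_mult)
    qed
  next
    case 3
    then show ?thesis using off p by blast
  qed
qed

text \<open>
  The powers of \<open>u\<close> need not converge, but they only rotate the difference of the two sequences.
\<close>

lemma eq_if_rotated_limits_eq:
  fixes C C' u m :: complex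
  assumes "norm u = 1" "(\<lambda>k. C * u ^ k) \<longlonglongrightarrow> m" "(\<lambda>k. C' * u ^ k) \<longlonglongrightarrow> m"
  shows "C = C'"
proof -
  have "(\<lambda>k. norm (C * u ^ k - C' * u ^ k)) \<longlonglongrightarrow> norm (m - m)"
    using assms by (intro tendsto_intros)
  moreover have "norm (C * u ^ k - C' * u ^ k) = norm (C - C')" for k
    using assms(1) by (simp add: left_diff_distrib[symmetric] norm_mult norm_power)
  ultimately have "(\<lambda>k::nat. norm (C - C')) \<longlonglongrightarrow> 0" by simp
  then show ?thesis by (simp add: LIMSEQ_const_iff)
qed

section \<open>The foliations of diagonal linear vector fields\<close>

locale nonreal_weight =
  fixes a :: complex
  assumes nonreal: "a \<notin> \<real>"
begin

lemma a_nonzero: "a \<noteq> 0"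
  using nonreal by auto

lemma Im_inverse_nonzero: "Im (1 / a) \<noteq> 0"
  using nonreal by (auto simp: Im_divide complex_is_Real_iff)

text \<open>
  Transversality: the pairing is \<open>a r + (1 - a) s\<close> with \<open>r + s = 1\<close> and \<open>r, s \<ge> 0\<close>. This segment from
  \<open>1 - a\<close> to \<open>a\<close> does not contain \<open>0\<close>, since it meets the real axis in its midpoint \<open>1/2\<close> only.
\<close>

sublocale transverse_holomorphic_form "\<lambda>z. (a - 1) * snd z" "\<lambda>z. a * fst z"
  "\<lambda>z. 0" "\<lambda>z. a - 1" "\<lambda>z. a" "\<lambda>z. 0"
proof
  show "((\<lambda>z. (a - 1) * snd z) has_derivative (\<lambda>u. 0 * fst u + (a - 1) * snd u)) (at z)" for z
    by (auto intro!: derivative_eq_intros)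
  show "((\<lambda>z. a * fst z) has_derivative (\<lambda>u. a * fst u + 0 * snd u)) (at z)" for z
    by (auto intro!: derivative_eq_intros)
  show "smooth_on UNIV (\<lambda>z::C2. (a - 1) * snd z)"
    by (intro smooth_on_mult[OF open_UNIV] smooth_on_const[OF open_UNIV]
        smooth_on_linear[OF open_UNIV] bounded_linear_snd)
  show "smooth_on UNIV (\<lambda>z::C2. a * fst z)"
    by (intro smooth_on_mult[OF open_UNIV] smooth_on_const[OF open_UNIV]
        smooth_on_linear[OF open_UNIV] bounded_linear_fst)
  fix z assume z: "z \<in> S3"
  have im: "Im a \<noteq> 0" using nonreal by (simp add: complex_is_Real_iff)
  define r s where "r = (norm (fst z))\<^sup>2" and "s = (norm (snd z))\<^sup>2"
  have rs: "r + s = 1" using z by (simp add: S3_iff r_def s_def)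
  have "a * fst z * cnj (fst z) - ((a - 1) * snd z) * cnj (snd z) = a * of_real r + (1 - a) * of_real s"
  proof -
    have "of_real r = fst z * cnj (fst z)" "of_real s = snd z * cnj (snd z)"
      unfolding r_def s_def by (rule complex_norm_square)+
    then show ?thesis by (simp add: algebra_simps)
  qed
  moreover have "\<dots> \<noteq> 0"
  proof
    assume "a * of_real r + (1 - a) * of_real s = 0"
    then have "Re a * r + (1 - Re a) * s = 0" "Im a * (r - s) = 0"
      by (auto simp: complex_eq_iff algebra_simps)
    then have "r = s" "Re a * r + (1 - Re a) * s = 0" using im by auto
    then have "s = 0" by (simp add: algebra_simps)
    with \<open>r = s\<close> rs show False by simp
  qed
  ultimately show "a * fst z * cnj (fst z) - ((a - 1) * snd z) * cnj (snd z) \<noteq> 0" by simp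
qed

lemma form_eq: "form = omega_a a"
  unfolding form_def[abs_def] omega_a_def by (auto simp: fun_eq_iff algebra_simps)

text \<open>
  Let \<open>\<kappa> = (1 - a) / a\<close>. On a leaf off the axes, \<open>log z\<^sub>2 - \<kappa> log z\<^sub>1 = c\<close> is constant, and \<open>z\<^sub>1 z\<^sub>2\<close> is an
  admissible \<open>f\<close>. As \<open>\<kappa>\<close> is not real, the leaf is a graph over \<open>t = log |z\<^sub>2| < 0\<close>: the moduli determine
  the arguments. For \<open>t \<rightarrow> -\<infinity>\<close> it spirals towards the circle \<open>z\<^sub>2 = 0\<close> while the argument \<open>\<theta>\<close> of \<open>z\<^sub>1\<close> tends
  to infinity in absolute value. Reading off \<open>\<mu>\<close> whenever \<open>z\<^sub>1\<close> is positive, that is at the successive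
  returns to a transversal of this circle, gives the sequence in the lemma: \<open>\<mu>\<close> converges to its value at
  \<open>(1, 0)\<close> and each return contributes the same factor of modulus \<open>1\<close>.
\<close>

lemma leafwise_constant_limit:
  assumes \<mu>: "leafwise_constant \<mu>" and p: "p \<in> S3" "fst p \<noteq> 0" "snd p \<noteq> 0"
  shows "(\<lambda>k. \<mu> p * cis (- 2 * Im (Ln (fst p) / a)) * cis (4 * pi * sgn (Im (1 / a)) * Re (1 / a)) ^ k)
    \<longlonglongrightarrow> \<mu> (1, 0)"
proof -
  define \<kappa> where "\<kappa> = 1 / a - 1"
  define c where "c = Ln (snd p) - \<kappa> * Ln (fst p)"
  \<comment> \<open>x t = log |z1| on the sphere, \<theta> t is the argument of z1, and the logarithms of z1, z2 are L1 t, L2 t\<close>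
  define x where "x = (\<lambda>t::real. ln (1 - exp (2 * t)) / 2)"
  define \<theta> where "\<theta> = (\<lambda>t. (Re c - t + Re \<kappa> * x t) / Im \<kappa>)"
  define L1 where "L1 = (\<lambda>t. Complex (x t) (\<theta> t))"
  define L2 where "L2 = (\<lambda>t. c + \<kappa> * L1 t)"
  define t0 where "t0 = ln (norm (snd p))"
  have \<kappa>: "Im \<kappa> \<noteq> 0" "Im \<kappa> = Im (1 / a)" "1 + \<kappa> = 1 / a" "Re (1 / a) = 1 + Re \<kappa>"
    using Im_inverse_nonzero by (simp_all add: \<kappa>_def)
  have S: "(norm (fst p))\<^sup>2 + (norm (snd p))\<^sup>2 = 1" using p S3_iff by simp
  have norms: "norm (fst p) > 0" "norm (snd p) > 0" using p by auto
  have t0: "t0 < 0"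
  proof -
    have "(norm (snd p))\<^sup>2 < 1" using S norms by (smt (verit) zero_less_power)
    then show ?thesis using norms by (simp add: t0_def power_less_one_iff abs_square_less_1)
  qed
  have e2: "exp (2 * t) < 1" if "t \<le> t0" for t using that t0 by simp
  have ReL2: "Re (L2 t) = t" for t
    using \<kappa>(1) by (simp add: L2_def L1_def \<theta>_def field_simps)
  have x0: "x t0 = ln (norm (fst p))"
  proof -
    have "exp (2 * t0) = (norm (snd p))\<^sup>2"
      using norms by (simp add: t0_def exp_double)
    moreover have "1 - (norm (snd p))\<^sup>2 = (norm (fst p))\<^sup>2" using S by simp
    ultimately have "x t0 = ln ((norm (fst p))\<^sup>2) / 2" by (simp only: x_def)
    then show ?thesis using norms by (simp add: ln_realpow)
  qed
  have "Re c - t0 + Re \<kappa> * x t0 = Im \<kappa> * Im (Ln (fst p))"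
  proof -
    have "Re (Ln (fst p)) = x t0" "Re (Ln (snd p)) = t0" unfolding x0 using p by (simp_all add: t0_def)
    then show ?thesis by (simp add: c_def)
  qed
  then have L1_0: "L1 t0 = Ln (fst p)" 
    using \<kappa>(1) p by (simp add: L1_def complex_eq_iff x0 \<theta>_def)
  then have L2_0: "L2 t0 = Ln (snd p)" by (simp add: L2_def c_def)
  define \<gamma> where "\<gamma> = (\<lambda>t. (exp (L1 t), exp (L2 t)))"
  define F where "F = (\<lambda>t. exp (L1 t + L2 t))"
  have \<gamma>0: "\<gamma> t0 = p" using p by (simp add: \<gamma>_def L1_0 L2_0)
  have \<gamma>S: "\<gamma> t \<in> S3" if "t \<le> t0" for t
  proof -
    have "(exp (x t))\<^sup>2 = exp (ln (1 - exp (2 * t)))"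
      by (simp add: x_def flip: exp_double)
    also have "\<dots> = 1 - exp (2 * t)" using e2[OF that] by simp
    finally show ?thesis
      by (simp add: S3_iff \<gamma>_def ReL2 L1_def flip: exp_double)
  qed
  have dL1: "\<exists>l. (L1 has_vector_derivative l) (at t)" if "t \<le> t0" for t
  proof -
    define d where "d = - exp (2 * t) / (1 - exp (2 * t))"
    have dx: "(x has_real_derivative d) (at t)"
      unfolding x_def d_def using e2[OF that]
      by (auto intro!: derivative_eq_intros simp: field_simps)
    have d\<theta>: "(\<theta> has_real_derivative (- 1 + Re \<kappa> * d) / Im \<kappa>) (at t)"
      unfolding \<theta>_def using \<kappa>(1) by (auto intro!: derivative_eq_intros dx)
    have "((\<lambda>t. of_real (x t) + \<i> * of_real (\<theta> t)) has_vector_derivative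
       of_real d + \<i> * of_real ((- 1 + Re \<kappa> * d) / Im \<kappa>)) (at t)"
      using dx d\<theta>
      by (intro has_vector_derivative_add has_vector_derivative_of_real has_vector_derivative_mult_right)
    then show ?thesis by (auto simp: L1_def Complex_eq)
  qed
  have der: "\<exists>l. (L1 has_vector_derivative l) (at t) \<and>
     (\<gamma> has_vector_derivative (l / a * (a * fst (\<gamma> t)), - (l / a * ((a - 1) * snd (\<gamma> t))))) (at t) \<and>
     (F has_vector_derivative l / a * D (\<gamma> t) * F t) (at t)" if le: "t \<le> t0" for t
  proof -
    obtain l where l: "(L1 has_vector_derivative l) (at t)" using dL1[OF le] by blast
    have l2: "(L2 has_vector_derivative \<kappa> * l) (at t)"
      unfolding L2_def using has_vector_derivative_add[OF has_vector_derivative_const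
          has_vector_derivative_mult_right[OF l]] by simp
    have "(\<gamma> has_vector_derivative (l * exp (L1 t), \<kappa> * l * exp (L2 t))) (at t)"
      unfolding \<gamma>_def
      by (intro has_vector_derivative_Pair has_vector_derivative_exp_compose l l2)
    moreover have "(F has_vector_derivative (l + \<kappa> * l) * exp (L1 t + L2 t)) (at t)"
      unfolding F_def by (intro has_vector_derivative_exp_compose has_vector_derivative_add l l2)
    moreover have "l / a * (a * fst (\<gamma> t)) = l * exp (L1 t)"
      "- (l / a * ((a - 1) * snd (\<gamma> t))) = \<kappa> * l * exp (L2 t)"
      "l / a * D (\<gamma> t) * F t = (l + \<kappa> * l) * exp (L1 t + L2 t)"
      using a_nonzero by (simp_all add: \<gamma>_def F_def D_def \<kappa>_def field_simps)
    ultimately show ?thesis using l by (intro exI[of _ l]) simp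
  qed
  have "isCont F t \<and> isCont \<gamma> t \<and> isCont L1 t" if "t \<le> t0" for t
    using der[OF that] by (auto dest: has_vector_derivative_continuous)
  then have contF: "continuous_on {..t0} F" and cont\<gamma>: "continuous_on {..t0} \<gamma>"
    and contL: "continuous_on {..t0} L1"
    by (simp_all add: continuous_at_imp_continuous_on)
  have leaf: "leaf_curve t t0 \<gamma> F" if "t \<le> t0" for t
    unfolding leaf_curve_def
  proof (intro conjI ballI)
    show "continuous_on {t..t0} \<gamma>" "continuous_on {t..t0} F"
      by (auto intro: continuous_on_subset[OF cont\<gamma>] continuous_on_subset[OF contF])
  next
    fix s assume "s \<in> {t<..<t0}"
    then have "s \<le> t0" by simp
    from der[OF this] show "\<exists>\<rho>. (\<gamma> has_vector_derivative (\<rho> * (a * fst (\<gamma> s)), - (\<rho> * ((a - 1) * snd (\<gamma> s))))) (at s) \<and>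
        (F has_vector_derivative \<rho> * D (\<gamma> s) * F s) (at s)"
      by blast
  qed (auto simp: \<gamma>S F_def)
  \<comment> \<open>the invariant, compared at t and at the point p, where the constant c cancels\<close>
  have inv: "\<mu> (\<gamma> t) * cis (- 2 * (Im (1 / a) * x t)) * cis (- 2 * Re (1 / a) * \<theta> t) =
      \<mu> p * cis (- 2 * Im (Ln (fst p) / a))" if "t \<le> t0" for t
  proof -
    have "\<mu> (\<gamma> t) * (cnj (F t) / F t) = \<mu> (\<gamma> t0) * (cnj (F t0) / F t0)"
      using \<mu> that leaf[OF that] unfolding leafwise_constant_def by blast
    then have 1: "\<mu> (\<gamma> t) * cis (- 2 * Im (L1 t + L2 t)) = \<mu> p * cis (- 2 * Im (L1 t0 + L2 t0))"
      unfolding F_def cnj_exp_quotient \<gamma>0 .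
    have 2: "L1 t + L2 t = c + L1 t / a" for t
      by (simp add: L2_def \<kappa>_def algebra_simps)
    have 3: "Im (L1 t / a) = Im (1 / a) * x t + Re (1 / a) * \<theta> t" for t
    proof -
      have "Im (L1 t / a) = Im (1 / a * L1 t)" by simp
      also have "\<dots> = Im (1 / a) * x t + Re (1 / a) * \<theta> t"
        unfolding times_complex.sel by (simp add: L1_def)
      finally show ?thesis .
    qed
    have split: "cis (- 2 * Im (L1 t + L2 t)) = cis (- 2 * Im c) * cis (- 2 * Im (L1 t / a))" for t
      unfolding 2 by (simp add: cis_mult algebra_simps)
    have "cis (- 2 * Im (L1 t / a)) = cis (- 2 * (Im (1 / a) * x t)) * cis (- 2 * Re (1 / a) * \<theta> t)"
      unfolding 3 cis_mult by (simp add: algebra_simps)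
    with 1 show ?thesis unfolding split by (simp add: L1_0 mult.assoc)
  qed
  have lim_exp: "((\<lambda>t::real. exp (2 * t)) \<longlongrightarrow> 0) at_bot"
    by (rule filterlim_compose[OF exp_at_bot filterlim_tendsto_pos_mult_at_bot[OF tendsto_const _ filterlim_ident]]) simp
  have lim_x: "(x \<longlongrightarrow> 0) at_bot"
    unfolding x_def by (rule tendsto_eq_intros lim_exp refl | simp)+
  \<comment> \<open>g tends to +\<infinity> for either sign of Im \<kappa>; at its multiples of 2 * pi * |Im \<kappa>| the coordinate z1 is positive\<close>
  define g where "g = (\<lambda>t. Im \<kappa> * \<theta> t)"
  have "g = (\<lambda>t. (Re c + Re \<kappa> * x t) + (- t))"
    using \<kappa>(1) by (auto simp: g_def \<theta>_def)
  moreover have "((\<lambda>t. Re c + Re \<kappa> * x t) \<longlongrightarrow> Re c + Re \<kappa> * 0) at_bot"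
    by (intro tendsto_intros lim_x)
  ultimately have g_top: "filterlim g at_top at_bot"
    using filterlim_tendsto_add_at_top filterlim_uminus_at_top_at_bot by metis
  have "continuous_on {..t0} (\<lambda>t. Im \<kappa> * Im (L1 t))"
    by (intro continuous_intros contL)
  then have g_cont: "continuous_on {..t0} g" by (simp add: g_def L1_def)
  obtain t where t_lim: "filterlim t at_bot sequentially"
    and t_ev: "eventually (\<lambda>k. t k \<le> t0 \<and> g (t k) = (2 * pi * \<bar>Im \<kappa>\<bar>) * real k) sequentially"
    using level_sequence[OF g_cont g_top, of "2 * pi * \<bar>Im \<kappa>\<bar>"] \<kappa>(1) by auto
  have xt: "(\<lambda>k. x (t k)) \<longlonglongrightarrow> 0" by (rule filterlim_compose[OF lim_x t_lim])
  have theta: "\<theta> (t k) = 2 * pi * (sgn (Im \<kappa>) * real k)" if "g (t k) = (2 * pi * \<bar>Im \<kappa>\<bar>) * real k" for k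
  proof -
    have "Im \<kappa> * \<theta> (t k) = Im \<kappa> * (2 * pi * (sgn (Im \<kappa>) * real k))"
      using that by (simp add: g_def abs_sgn mult.assoc)
    then show ?thesis using \<kappa>(1) mult_left_cancel by blast
  qed
  have cis1: "cis (2 * pi * (sgn (Im \<kappa>) * real k)) = 1" for k
    using \<kappa>(1) cis_multiple_2pi[of "real k"] cis_multiple_2pi[of "- real k"]
    by (auto simp: sgn_if)
  have "(\<lambda>k. exp (L1 (t k))) \<longlonglongrightarrow> 1"
  proof (rule Lim_transform_eventually)
    show "(\<lambda>k. complex_of_real (exp (x (t k)))) \<longlonglongrightarrow> 1"
      by (rule tendsto_eq_intros xt refl | simp)+
    show "eventually (\<lambda>k. complex_of_real (exp (x (t k))) = exp (L1 (t k))) sequentially"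
      using t_ev by eventually_elim (auto simp: exp_eq_polar L1_def theta cis1)
  qed
  moreover have "(\<lambda>k. exp (L2 (t k))) \<longlonglongrightarrow> 0"
    by (rule tendsto_norm_zero_cancel) (simp add: ReL2 filterlim_compose[OF exp_at_bot t_lim])
  ultimately have "(\<lambda>k. \<gamma> (t k)) \<longlonglongrightarrow> (1, 0)" unfolding \<gamma>_def by (rule tendsto_Pair)
  moreover have "(1, 0) \<in> S3" by (simp add: S3_iff)
  moreover have "eventually (\<lambda>k. \<gamma> (t k) \<in> S3) sequentially"
    using t_ev by eventually_elim (simp add: \<gamma>S)
  moreover have "continuous_on S3 \<mu>" using \<mu> by (simp add: leafwise_constant_def)
  ultimately have mu: "(\<lambda>k. \<mu> (\<gamma> (t k))) \<longlonglongrightarrow> \<mu> (1, 0)"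
    by (intro continuous_on_tendsto_compose[of S3 \<mu>])
  have "(\<lambda>k. cis (- 2 * (Im (1 / a) * x (t k)))) \<longlonglongrightarrow> cis (- 2 * (Im (1 / a) * 0))"
    by (intro tendsto_intros xt)
  then have lim: "(\<lambda>k. \<mu> (\<gamma> (t k)) * cis (- 2 * (Im (1 / a) * x (t k)))) \<longlonglongrightarrow> \<mu> (1, 0)"
    using tendsto_mult[OF mu] by fastforce
  show ?thesis
  proof (rule Lim_transform_eventually[OF lim], use t_ev in eventually_elim)
    case (elim k)
    define u where "u = cis (4 * pi * sgn (Im (1 / a)) * Re (1 / a)) ^ k"
    define v where "v = cis (- 2 * Re (1 / a) * \<theta> (t k))"
    define m where "m = \<mu> (\<gamma> (t k)) * cis (- 2 * (Im (1 / a) * x (t k)))"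
    have "u * v = 1"
      using theta elim unfolding u_def v_def Complex.DeMoivre cis_mult \<kappa>(2)[symmetric] by simp
    then have "m = m * v * u" by (simp add: mult.assoc mult.commute[of v u])
    also have "m * v = \<mu> p * cis (- 2 * Im (Ln (fst p) / a))"
      using inv[of "t k"] elim by (simp only: m_def v_def)
    finally show ?case by (simp only: m_def u_def)
  qed
qed

text \<open>
  The previous limit determines the constant \<open>C = \<mu> exp (-2 \<i> Im (log z\<^sub>1 / a))\<close> independently of the
  point off the axes. If \<open>C \<noteq> 0\<close> then the argument of \<open>\<mu>\<close> would change without limit when \<open>z\<^sub>1\<close> tends to \<open>0\<close>
  along the positive reals, since \<open>1 / a\<close> is not real, contradicting the continuity of \<open>\<mu>\<close> at \<open>(0, 1)\<close>.
\<close>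

lemma leafwise_constant_vanishes:
  assumes \<mu>: "leafwise_constant \<mu>" and p: "p \<in> S3"
  shows "\<mu> p = 0"
proof (rule vanish_on_S3_if_vanish_off_axes[OF _ p])
  show cont: "continuous_on S3 \<mu>" using \<mu> by (simp add: leafwise_constant_def)
  fix q assume q: "q \<in> S3" "fst q \<noteq> 0" "snd q \<noteq> 0"
  define C where "C = \<mu> q * cis (- 2 * Im (Ln (fst q) / a))"
  have C: "\<mu> r * cis (- 2 * Im (Ln (fst r) / a)) = C" if "r \<in> S3" "fst r \<noteq> 0" "snd r \<noteq> 0" for r
    unfolding C_def
    by (rule eq_if_rotated_limits_eq[OF norm_cis leafwise_constant_limit[OF \<mu> that]
          leafwise_constant_limit[OF \<mu> q]])
  define \<tau> where "\<tau> = Im (1 / a)"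
  have \<tau>: "\<tau> \<noteq> 0" using Im_inverse_nonzero by (simp add: \<tau>_def)
  \<comment> \<open>at these values of log |z1| the phase factor is alternately -1 and 1\<close>
  define x where "x = (\<lambda>j::nat. - (pi / (2 * \<bar>\<tau>\<bar>)) * real (Suc j))"
  define r where "r = (\<lambda>j. (complex_of_real (exp (x j)), complex_of_real (sqrt (1 - exp (2 * x j)))))"
  have x0: "x j < 0" for j using \<tau> by (simp add: x_def mult_pos_pos)
  have e: "exp (2 * x j) < 1" for j using x0[of j] by simp
  have rS: "r j \<in> S3" "fst (r j) \<noteq> 0" "snd (r j) \<noteq> 0" for j
    using e[of j] by (simp_all add: S3_iff r_def flip: exp_double)
  have "\<mu> (r j) = C * (- 1) ^ Suc j" for j
  proof -
    have "Ln (fst (r j)) = of_real (x j)" by (simp add: r_def Ln_of_real)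
    then have "Im (Ln (fst (r j)) / a) = x j * \<tau>"
      unfolding \<tau>_def by (metis Im_complex_of_real Re_complex_of_real add.right_neutral mult_zero_left times_complex.sel(2) divide_inverse mult_1)
    moreover have "- 2 * (x j * \<tau>) = real (Suc j) * (sgn \<tau> * pi)"
      using \<tau> by (cases "\<tau> > 0") (simp_all add: x_def field_simps)
    ultimately have "- 2 * Im (Ln (fst (r j)) / a) = real (Suc j) * (sgn \<tau> * pi)" by simp
    then have "cis (- 2 * Im (Ln (fst (r j)) / a)) = cis (sgn \<tau> * pi) ^ Suc j"
      by (simp only: Complex.DeMoivre)
    also have "cis (sgn \<tau> * pi) = - 1" using \<tau> by (auto simp: sgn_if complex_eq_iff)
    finally have "\<mu> (r j) * (- 1) ^ Suc j = C" using C[OF rS] by metis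
    then show ?thesis by (auto simp: minus_one_power_iff)
  qed
  moreover have "filterlim x at_bot sequentially"
    unfolding x_def using \<tau>
    by (intro filterlim_tendsto_neg_mult_at_bot[OF tendsto_const]
        filterlim_compose[OF filterlim_real_sequentially filterlim_Suc]) auto
  then have "(\<lambda>j. exp (x j)) \<longlonglongrightarrow> 0" by (rule filterlim_compose[OF exp_at_bot])
  then have "r \<longlonglongrightarrow> (of_real 0, of_real (sqrt (1 - 0\<^sup>2)))"
    unfolding r_def exp_double by (intro tendsto_intros)
  then have "(\<lambda>j. \<mu> (r j)) \<longlonglongrightarrow> \<mu> (0, 1)"
    using rS by (intro continuous_on_tendsto_compose[OF cont]) (auto simp: S3_iff)
  ultimately have lim: "(\<lambda>j. C * (- 1) ^ Suc j) \<longlonglongrightarrow> \<mu> (0, 1)" by simp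
  have "- C = C"
    by (rule eq_if_rotated_limits_eq[of "- 1" _ "\<mu> (0, 1)"]) (use lim LIMSEQ_Suc[OF lim] in simp_all)
  then have "C = 0" by simp
  then show "\<mu> q = 0" by (simp add: C_def)
qed

end

section \<open>The foliations of resonant vector fields\<close>

locale positive_index =
  fixes n :: nat
  assumes n_pos: "n \<ge> 1"
begin

text \<open>
  Transversality: in \<open>n |z\<^sub>1|\<^sup>2 + |z\<^sub>2|\<^sup>2 + z\<^sub>2\<^sup>n cnj z\<^sub>1\<close> the last term has modulus at most
  \<open>|z\<^sub>1| |z\<^sub>2| \<le> 1/2\<close> on the sphere, while the others sum to at least \<open>1\<close>.
\<close>

sublocale transverse_holomorphic_form "\<lambda>z. - snd z" "\<lambda>z. of_nat n * fst z + snd z ^ n"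
  "\<lambda>z. 0" "\<lambda>z. - 1" "\<lambda>z. of_nat n" "\<lambda>z. of_nat n * snd z ^ (n - 1)"
proof
  show "((\<lambda>z. - snd z) has_derivative (\<lambda>u. 0 * fst u + - 1 * snd u)) (at z)" for z :: C2
    by (auto intro!: derivative_eq_intros)
  show "((\<lambda>z. of_nat n * fst z + snd z ^ n) has_derivative
      (\<lambda>u. of_nat n * fst u + of_nat n * snd z ^ (n - 1) * snd u)) (at z)" for z :: C2
    by (auto intro!: derivative_eq_intros simp: fun_eq_iff algebra_simps)
  show "smooth_on UNIV (\<lambda>z::C2. - snd z)"
    by (intro smooth_on_minus[OF open_UNIV] smooth_on_linear[OF open_UNIV] bounded_linear_snd)
  show "smooth_on UNIV (\<lambda>z::C2. of_nat n * fst z + snd z ^ n)"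
    by (intro smooth_on_add[OF open_UNIV] smooth_on_mult[OF open_UNIV] smooth_on_power[OF open_UNIV]
        smooth_on_const[OF open_UNIV] smooth_on_linear[OF open_UNIV] bounded_linear_snd bounded_linear_fst)
  fix z :: C2 assume z: "z \<in> S3"
  define r s where "r = norm (fst z)" and "s = norm (snd z)"
  have rs: "r\<^sup>2 + s\<^sup>2 = 1" and nn: "0 \<le> r" "0 \<le> s" using z by (simp_all add: S3_iff r_def s_def)
  have "s \<le> 1" using rs nn by (metis abs_le_square_iff abs_of_nonneg le_add_same_cancel2 one_power2 zero_le_one zero_le_power2)
  then have "s ^ n \<le> s ^ 1" using n_pos nn by (intro power_decreasing) auto
  then have "s ^ n * r \<le> s * r" using nn by (simp add: mult_right_mono)
  moreover have "2 * (s * r) \<le> r\<^sup>2 + s\<^sup>2" using sum_squares_bound[of s r] by simp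
  moreover have "1 * r\<^sup>2 \<le> real n * r\<^sup>2" using n_pos by (intro mult_right_mono) auto
  ultimately have pos: "s ^ n * r < real n * r\<^sup>2 + s\<^sup>2" using rs by linarith
  have "of_real (r\<^sup>2) = fst z * cnj (fst z)" "of_real (s\<^sup>2) = snd z * cnj (snd z)"
    unfolding r_def s_def by (rule complex_norm_square)+
  then have eq: "(of_nat n * fst z + snd z ^ n) * cnj (fst z) - - snd z * cnj (snd z) =
      of_real (real n * r\<^sup>2 + s\<^sup>2) + snd z ^ n * cnj (fst z)"
    by (simp add: algebra_simps)
  have "norm (snd z ^ n * cnj (fst z)) = s ^ n * r"
    by (simp add: norm_mult norm_power r_def s_def)
  moreover have "norm (complex_of_real (real n * r\<^sup>2 + s\<^sup>2)) = real n * r\<^sup>2 + s\<^sup>2"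
    unfolding norm_of_real by simp
  ultimately show "(of_nat n * fst z + snd z ^ n) * cnj (fst z) - - snd z * cnj (snd z) \<noteq> 0"
    unfolding eq using pos by (metis add_eq_0_iff less_irrefl norm_minus_cancel)
qed

lemma form_eq: "form = omega_n n"
  unfolding form_def[abs_def] omega_n_def by (auto simp: fun_eq_iff algebra_simps)

text \<open>
  With \<open>y = exp (n \<sigma>) (w + \<sigma>)\<close> and \<open>e = exp \<sigma>\<close>, this is the squared norm of the point \<open>(y, e)\<close> of a real orbit
  of the vector field \<open>X\<close>. It increases by the same estimate that gives transversality.
\<close>

lemma energy_strict_mono:
  fixes w :: real
  assumes "\<sigma> < \<sigma>'" "\<sigma>' \<le> 0"
  shows "exp (2 * real n * \<sigma>) * (w + \<sigma>)\<^sup>2 + exp (2 * \<sigma>) < exp (2 * real n * \<sigma>') * (w + \<sigma>')\<^sup>2 + exp (2 * \<sigma>')"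
proof (rule DERIV_pos_imp_increasing[OF assms(1)])
  fix x assume x: "\<sigma> \<le> x" "x \<le> \<sigma>'"
  define b e y where "b = exp (real n * x)" and "e = exp x" and "y = b * (w + x)"
  have "real n * x \<le> 1 * x" using n_pos x assms by (intro mult_right_mono_neg) auto
  then have be: "b \<le> e" "0 < b" "0 < e" by (simp_all add: b_def e_def)
  have ex: "exp (2 * real n * x) = b\<^sup>2" "exp (2 * x) = e\<^sup>2"
    by (simp_all add: b_def e_def mult.assoc flip: exp_double)
  have d: "((\<lambda>\<sigma>. exp (2 * real n * \<sigma>) * (w + \<sigma>)\<^sup>2 + exp (2 * \<sigma>)) has_real_derivative
      exp (2 * real n * x) * (2 * real n) * (w + x)\<^sup>2 + 2 * (w + x) * exp (2 * real n * x)
      + 2 * exp (2 * x)) (at x)"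
    by (auto intro!: derivative_eq_intros simp: algebra_simps)
  have eq: "exp (2 * real n * x) * (2 * real n) * (w + x)\<^sup>2 + 2 * (w + x) * exp (2 * real n * x)
      + 2 * exp (2 * x) = 2 * (real n * y\<^sup>2 + b * y + e\<^sup>2)"
    unfolding ex y_def by (simp add: algebra_simps power2_eq_square)
  have pos: "0 < real n * y\<^sup>2 + b * y + e\<^sup>2"
  proof -
    have "1 * y\<^sup>2 \<le> real n * y\<^sup>2" using n_pos by (intro mult_right_mono) auto
    moreover have "- (b * y) \<le> e * \<bar>y\<bar>"
      using be by (metis abs_ge_minus_self abs_mult abs_of_pos mult_right_mono abs_ge_zero order_trans)
    moreover have "2 * (e * \<bar>y\<bar>) \<le> e\<^sup>2 + y\<^sup>2" using sum_squares_bound[of e "\<bar>y\<bar>"] by simp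
    moreover have "0 < e\<^sup>2" using be by simp
    moreover have "0 \<le> y\<^sup>2" by simp
    ultimately show ?thesis by linarith
  qed
  show "\<exists>d. ((\<lambda>\<sigma>. exp (2 * real n * \<sigma>) * (w + \<sigma>)\<^sup>2 + exp (2 * \<sigma>)) has_real_derivative d) (at x) \<and> 0 < d"
    using d[unfolded eq] mult_pos_pos[OF zero_less_numeral pos] by blast
qed

text \<open>
  On a leaf with \<open>z\<^sub>2 \<noteq> 0\<close> the function \<open>c = z\<^sub>1 / z\<^sub>2\<^sup>n - log z\<^sub>2\<close> is constant, and \<open>z\<^sub>2\<^sup>n\<^sup>+\<^sup>1\<close> is an admissible
  \<open>f\<close>. With \<open>s = log z\<^sub>2 = \<sigma> + \<i> \<tau>\<close> the leaf consists of the points \<open>(exp (n s) (c + s), exp s)\<close>, and the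
  equation of the sphere is a quadratic equation for \<open>\<tau>\<close> in terms of \<open>\<sigma>\<close>. Its solutions
  are distinguished by the sign \<open>\<epsilon>\<close> of the imaginary part of \<open>c + s = z\<^sub>1 / z\<^sub>2\<^sup>n\<close>. By
  \<open>energy_strict_mono\<close> they extend from any point of the leaf to \<open>\<sigma> \<rightarrow> -\<infinity>\<close>. There \<open>\<epsilon> \<tau> \<rightarrow> \<infinity>\<close>
  and the imaginary part of \<open>c + s\<close> dominates, so that at the points with \<open>z\<^sub>2 > 0\<close> the coordinate \<open>z\<^sub>1\<close> tends
  to \<open>\<epsilon> \<i>\<close>, while \<open>f\<close> is positive there. Hence the invariant is the value of \<open>\<mu>\<close> at the limit point.
\<close>

lemma leafwise_constant_value:
  fixes \<epsilon> :: real
  assumes \<mu>: "leafwise_constant \<mu>" and p: "p \<in> S3" "snd p \<noteq> 0"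
    and \<epsilon>: "\<epsilon> = 1 \<or> \<epsilon> = - 1" "0 \<le> \<epsilon> * Im (fst p / snd p ^ n)"
  shows "\<mu> p * (cnj (snd p) / snd p) ^ Suc n = \<mu> (Complex 0 \<epsilon>, 0)"
proof -
  define s0 where "s0 = Ln (snd p)"
  define c where "c = fst p / snd p ^ n - s0"
  define \<sigma>0 where "\<sigma>0 = Re s0"
  define w where "w = Re c"
  \<comment> \<open>E is the squared norm of the point with c + s replaced by its real part w + \<sigma>, and G is the square
    of the imaginary part of c + s that puts the point on the sphere\<close>
  define E where "E = (\<lambda>\<sigma>. exp (2 * real n * \<sigma>) * (w + \<sigma>)\<^sup>2 + exp (2 * \<sigma>))"
  define G where "G = (\<lambda>\<sigma>. exp (- (2 * real n * \<sigma>)) * (1 - E \<sigma>))"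
  define \<tau> where "\<tau> = (\<lambda>\<sigma>. - Im c + \<epsilon> * sqrt (G \<sigma>))"
  define s where "s = (\<lambda>\<sigma>. Complex \<sigma> (\<tau> \<sigma>))"
  define \<gamma> where "\<gamma> = (\<lambda>\<sigma>. (exp (of_nat n * s \<sigma>) * (c + s \<sigma>), exp (s \<sigma>)))"
  define F where "F = (\<lambda>\<sigma>. exp (of_nat (Suc n) * s \<sigma>))"
  have S: "(norm (fst p))\<^sup>2 + (norm (snd p))\<^sup>2 = 1" using p S3_iff by simp
  have es0: "exp s0 = snd p" using p by (simp add: s0_def)
  have ens: "exp (of_nat n * z) = exp z ^ n" for z :: complex by (rule exp_of_nat_mult)
  have sq: "(exp (real n * \<sigma>))\<^sup>2 = exp (2 * real n * \<sigma>)" for \<sigma>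
    by (simp add: mult.assoc flip: exp_double)
  have "(norm (snd p))\<^sup>2 = exp (2 * \<sigma>0)"
    unfolding es0[symmetric] \<sigma>0_def by (simp flip: exp_double)
  moreover have "fst p = exp (of_nat n * s0) * (c + s0)"
    using p by (simp add: c_def ens es0)
  then have "(norm (fst p))\<^sup>2 = exp (2 * real n * \<sigma>0) * ((w + \<sigma>0)\<^sup>2 + (Im (c + s0))\<^sup>2)"
    by (simp add: norm_mult power_mult_distrib sq cmod_power2 w_def \<sigma>0_def)
  ultimately have E0: "1 - E \<sigma>0 = exp (2 * real n * \<sigma>0) * (Im (c + s0))\<^sup>2"
    using S by (simp add: E_def algebra_simps)
  then have G0: "G \<sigma>0 = (Im (c + s0))\<^sup>2"
    by (simp add: G_def exp_minus)
  have \<sigma>0: "\<sigma>0 \<le> 0"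
  proof -
    have "exp (2 * \<sigma>0) \<le> 1" using S \<open>(norm (snd p))\<^sup>2 = exp (2 * \<sigma>0)\<close>
      by (metis le_add_same_cancel2 zero_le_power2)
    then show ?thesis by simp
  qed
  have E1: "E \<sigma> < 1" if "\<sigma> < \<sigma>0" for \<sigma>
  proof -
    have "E \<sigma> < E \<sigma>0" unfolding E_def by (rule energy_strict_mono[OF that \<sigma>0])
    also have "\<dots> \<le> 1" using E0 by (metis diff_ge_0_iff_ge exp_ge_zero mult_nonneg_nonneg zero_le_power2)
    finally show ?thesis .
  qed
  have Gpos: "0 < G \<sigma>" if "\<sigma> < \<sigma>0" for \<sigma> using E1[OF that] by (simp add: G_def)
  have Gnn: "0 \<le> G \<sigma>" if "\<sigma> \<le> \<sigma>0" for \<sigma>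
    using that Gpos[of \<sigma>] G0 by (cases "\<sigma> = \<sigma>0") auto
  have "c + s0 = fst p / snd p ^ n" by (simp add: c_def)
  then have "\<epsilon> * \<bar>Im (c + s0)\<bar> = Im (c + s0)" using \<epsilon> by auto
  then have "\<tau> \<sigma>0 = Im s0" by (simp add: \<tau>_def G0)
  then have s_0: "s \<sigma>0 = s0" by (simp add: s_def \<sigma>0_def complex_eq_iff)
  have \<gamma>0: "\<gamma> \<sigma>0 = p"
    using \<open>fst p = exp (of_nat n * s0) * (c + s0)\<close> by (simp add: \<gamma>_def s_0 es0 prod_eq_iff)
  have Re_s: "Re (s \<sigma>) = \<sigma>" for \<sigma> by (simp add: s_def)
  have cs: "c + s \<sigma> = Complex (w + \<sigma>) (\<epsilon> * sqrt (G \<sigma>))" for \<sigma>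
    by (simp add: s_def w_def \<tau>_def complex_eq_iff)
  have \<gamma>S: "\<gamma> \<sigma> \<in> S3" if "\<sigma> \<le> \<sigma>0" for \<sigma>
  proof -
    have "(norm (fst (\<gamma> \<sigma>)))\<^sup>2 = exp (2 * real n * \<sigma>) * ((w + \<sigma>)\<^sup>2 + G \<sigma>)"
      using Gnn[OF that] \<epsilon>(1)
      by (auto simp: \<gamma>_def cs norm_mult power_mult_distrib sq cmod_power2 Re_s)
    also have "\<dots> = 1 - exp (2 * \<sigma>)"
      by (simp add: G_def E_def exp_minus field_simps)
    finally show ?thesis by (simp add: S3_iff \<gamma>_def s_def flip: exp_double)
  qed
  have contE: "continuous_on A E" for A unfolding E_def by (intro continuous_intros)
  have contG: "continuous_on A G" for A unfolding G_def by (intro continuous_intros contE)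
  have conts: "continuous_on A s" for A
    unfolding s_def Complex_eq \<tau>_def by (intro continuous_intros contG)
  have cont\<gamma>: "continuous_on A \<gamma>" and contF: "continuous_on A F" for A
    unfolding \<gamma>_def F_def by (intro continuous_intros conts)+
  \<comment> \<open>at \<sigma>0 itself G may vanish, and then \<tau> is not differentiable\<close>
  have ds: "\<exists>l. (s has_vector_derivative l) (at \<sigma>)" if "\<sigma> < \<sigma>0" for \<sigma>
  proof -
    have "\<exists>d. (G has_real_derivative d) (at \<sigma>)"
      unfolding G_def E_def by (rule exI, (rule derivative_eq_intros refl | simp)+)
    then obtain d where dG: "(G has_real_derivative d) (at \<sigma>)" ..
    have d\<tau>: "(\<tau> has_real_derivative \<epsilon> * (inverse (sqrt (G \<sigma>)) / 2 * d)) (at \<sigma>)"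
      using DERIV_add[OF DERIV_const DERIV_cmult[OF DERIV_chain2[OF DERIV_real_sqrt[OF Gpos[OF that]] dG]]]
      unfolding \<tau>_def add_0 .
    have "((\<lambda>\<sigma>. of_real \<sigma> + \<i> * of_real (\<tau> \<sigma>)) has_vector_derivative
       of_real 1 + \<i> * of_real (\<epsilon> * (inverse (sqrt (G \<sigma>)) / 2 * d))) (at \<sigma>)"
      by (intro has_vector_derivative_add has_vector_derivative_of_real has_vector_derivative_mult_right
          d\<tau> DERIV_ident)
    then show ?thesis unfolding s_def Complex_eq by blast
  qed
  have leaf: "leaf_curve \<sigma> \<sigma>0 \<gamma> F" for \<sigma>
    unfolding leaf_curve_def
  proof (intro conjI ballI)
    show "continuous_on {\<sigma>..\<sigma>0} \<gamma>" "continuous_on {\<sigma>..\<sigma>0} F" by (rule cont\<gamma> contF)+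
  next
    fix t assume "t \<in> {\<sigma><..<\<sigma>0}"
    then obtain l where l: "(s has_vector_derivative l) (at t)" using ds by auto
    have "((\<lambda>x. exp (of_nat n * s x) * (c + s x)) has_vector_derivative
        exp (of_nat n * s t) * (0 + l) + of_nat n * l * exp (of_nat n * s t) * (c + s t)) (at t)"
      by (intro has_vector_derivative_mult has_vector_derivative_exp_compose
          has_vector_derivative_mult_right has_vector_derivative_add has_vector_derivative_const l)
    then have "(\<gamma> has_vector_derivative
        (exp (of_nat n * s t) * (0 + l) + of_nat n * l * exp (of_nat n * s t) * (c + s t), l * exp (s t))) (at t)"
      unfolding \<gamma>_def by (intro has_vector_derivative_Pair has_vector_derivative_exp_compose l)
    moreover have "exp (of_nat n * s t) * (0 + l) + of_nat n * l * exp (of_nat n * s t) * (c + s t) =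
        l * (of_nat n * fst (\<gamma> t) + snd (\<gamma> t) ^ n)" "l * exp (s t) = - (l * - snd (\<gamma> t))"
      by (simp_all add: \<gamma>_def ens algebra_simps)
    moreover have "(F has_vector_derivative of_nat (Suc n) * l * exp (of_nat (Suc n) * s t)) (at t)"
      unfolding F_def by (intro has_vector_derivative_exp_compose has_vector_derivative_mult_right l)
    moreover have "of_nat (Suc n) * l * exp (of_nat (Suc n) * s t) = l * D (\<gamma> t) * F t"
      by (simp add: F_def D_def algebra_simps)
    ultimately show "\<exists>\<rho>. (\<gamma> has_vector_derivative
        (\<rho> * (of_nat n * fst (\<gamma> t) + snd (\<gamma> t) ^ n), - (\<rho> * - snd (\<gamma> t)))) (at t) \<and>
        (F has_vector_derivative \<rho> * D (\<gamma> t) * F t) (at t)"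
      by metis
  qed (auto simp: \<gamma>S F_def)
  have inv: "\<mu> (\<gamma> \<sigma>) * cis (- 2 * (real (Suc n) * \<tau> \<sigma>)) = \<mu> p * (cnj (snd p) / snd p) ^ Suc n"
    if "\<sigma> \<le> \<sigma>0" for \<sigma>
  proof -
    have "\<mu> (\<gamma> \<sigma>) * (cnj (F \<sigma>) / F \<sigma>) = \<mu> (\<gamma> \<sigma>0) * (cnj (F \<sigma>0) / F \<sigma>0)"
      using \<mu> that leaf[of \<sigma>] unfolding leafwise_constant_def by blast
    moreover have "cnj (F \<sigma>) / F \<sigma> = cis (- 2 * (real (Suc n) * \<tau> \<sigma>))"
    proof -
      have "Im (of_nat (Suc n) * s \<sigma>) = real (Suc n) * \<tau> \<sigma>"
        unfolding times_complex.sel by (simp add: s_def)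
      then show ?thesis by (simp only: F_def cnj_exp_quotient)
    qed
    moreover have "F \<sigma>0 = snd p ^ Suc n"
      unfolding F_def s_0 exp_of_nat_mult es0 ..
    then have "cnj (F \<sigma>0) / F \<sigma>0 = (cnj (snd p) / snd p) ^ Suc n"
      by (simp only: complex_cnj_power power_divide)
    ultimately show ?thesis by (simp only: \<gamma>0)
  qed
  have lin: "((\<lambda>\<sigma>. exp (real n * \<sigma>) * (w + \<sigma>)) \<longlongrightarrow> 0) at_bot"
  proof -
    have "0 < real n" using n_pos by simp
    then show ?thesis by real_asymp
  qed
  have e0: "((\<lambda>\<sigma>::real. exp (2 * \<sigma>)) \<longlongrightarrow> 0) at_bot" by real_asymp
  have "E = (\<lambda>\<sigma>. (exp (real n * \<sigma>) * (w + \<sigma>))\<^sup>2 + exp (2 * \<sigma>))"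
    by (simp add: E_def power_mult_distrib sq)
  moreover have "((\<lambda>\<sigma>. (exp (real n * \<sigma>) * (w + \<sigma>))\<^sup>2 + exp (2 * \<sigma>)) \<longlongrightarrow> 0\<^sup>2 + 0) at_bot"
    by (intro tendsto_intros lin e0)
  ultimately have limE: "(E \<longlongrightarrow> 0) at_bot" by simp
  have G_top: "filterlim G at_top at_bot"
    unfolding G_def
  proof (rule filterlim_at_top_mult_tendsto_pos[where c = 1])
    show "((\<lambda>\<sigma>. 1 - E \<sigma>) \<longlongrightarrow> 1) at_bot" by (rule tendsto_eq_intros limE refl | simp)+
    have "0 < real n" using n_pos by simp
    then show "filterlim (\<lambda>\<sigma>. exp (- (2 * real n * \<sigma>))) at_top at_bot" by real_asymp
  qed simp
  define g where "g = (\<lambda>\<sigma>. - (\<epsilon> * Im c) + sqrt (G \<sigma>))"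
  have g_top: "filterlim g at_top at_bot"
    unfolding g_def
    by (rule filterlim_tendsto_add_at_top[OF tendsto_const filterlim_compose[OF sqrt_at_top G_top]])
  have g_cont: "continuous_on {..\<sigma>0} g" unfolding g_def by (intro continuous_intros contG)
  have g\<tau>: "\<tau> \<sigma> = \<epsilon> * g \<sigma>" for \<sigma> using \<epsilon>(1) by (auto simp: \<tau>_def g_def)
  obtain t where t_lim: "filterlim t at_bot sequentially"
    and t_ev: "eventually (\<lambda>k. t k \<le> \<sigma>0 \<and> g (t k) = 2 * pi * real k) sequentially"
    using level_sequence[OF g_cont g_top, of "2 * pi"] by auto
  have cis1: "cis (real m * \<tau> (t k)) = 1" if "g (t k) = 2 * pi * real k" for m k
  proof -
    have "real m * \<tau> (t k) = 2 * pi * real_of_int (int m * int k) \<or>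
        real m * \<tau> (t k) = 2 * pi * real_of_int (- (int m * int k))"
      using \<epsilon>(1) that by (auto simp: g\<tau>)
    then show ?thesis using cis_multiple_2pi Ints_of_int by metis
  qed
  have "(\<lambda>k. exp (of_nat n * s (t k)) * (c + s (t k))) \<longlonglongrightarrow> Complex 0 \<epsilon>"
  proof (rule Lim_transform_eventually)
    have "((\<lambda>\<sigma>. \<epsilon> * sqrt (1 - E \<sigma>)) \<longlongrightarrow> \<epsilon> * sqrt (1 - 0)) at_bot"
      by (intro tendsto_intros limE)
    then have "((\<lambda>\<sigma>. Complex (exp (real n * \<sigma>) * (w + \<sigma>)) (\<epsilon> * sqrt (1 - E \<sigma>))) \<longlongrightarrow> Complex 0 (\<epsilon> * sqrt (1 - 0))) at_bot"
      by (intro tendsto_Complex lin)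
    from filterlim_compose[OF this t_lim]
    show "(\<lambda>k. Complex (exp (real n * t k) * (w + t k)) (\<epsilon> * sqrt (1 - E (t k)))) \<longlonglongrightarrow> Complex 0 \<epsilon>"
      by simp
    show "eventually (\<lambda>k. Complex (exp (real n * t k) * (w + t k)) (\<epsilon> * sqrt (1 - E (t k))) =
        exp (of_nat n * s (t k)) * (c + s (t k))) sequentially"
      using t_ev
    proof eventually_elim
      case (elim k)
      have "exp (of_nat n * s (t k)) = of_real (exp (real n * t k))"
      proof -
        have "Re (of_nat n * s (t k)) = real n * t k" "Im (of_nat n * s (t k)) = real n * \<tau> (t k)"
          by (simp_all add: s_def)
        then show ?thesis using cis1[of k n] elim by (simp only: exp_eq_polar mult_1_right)
      qed
      moreover have "exp (real n * t k) * sqrt (G (t k)) = sqrt (1 - E (t k))"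
      proof -
        have "exp (real n * t k) = sqrt (exp (2 * real n * t k))"
          unfolding sq[symmetric] by simp
        then show ?thesis by (simp add: G_def exp_minus flip: real_sqrt_mult)
      qed
      ultimately show ?case by (simp add: cs complex_eq_iff mult.left_commute)
    qed
  qed
  moreover have "(\<lambda>k. exp (s (t k))) \<longlonglongrightarrow> 0"
    by (rule tendsto_norm_zero_cancel) (simp add: s_def filterlim_compose[OF exp_at_bot t_lim])
  ultimately have "(\<lambda>k. \<gamma> (t k)) \<longlonglongrightarrow> (Complex 0 \<epsilon>, 0)" unfolding \<gamma>_def by (rule tendsto_Pair)
  moreover have "(Complex 0 \<epsilon>, 0) \<in> S3" using \<epsilon>(1) by (auto simp: S3_iff cmod_power2)
  moreover have "eventually (\<lambda>k. \<gamma> (t k) \<in> S3) sequentially"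
    using t_ev by eventually_elim (simp add: \<gamma>S)
  moreover have "continuous_on S3 \<mu>" using \<mu> by (simp add: leafwise_constant_def)
  ultimately have mu: "(\<lambda>k. \<mu> (\<gamma> (t k))) \<longlonglongrightarrow> \<mu> (Complex 0 \<epsilon>, 0)"
    by (intro continuous_on_tendsto_compose[of S3 \<mu>])
  have "eventually (\<lambda>k. \<mu> (\<gamma> (t k)) = \<mu> p * (cnj (snd p) / snd p) ^ Suc n) sequentially"
    using t_ev
  proof eventually_elim
    case (elim k)
    have "cis (- 2 * (real (Suc n) * \<tau> (t k))) = inverse (cis (real (2 * Suc n) * \<tau> (t k)))"
      unfolding cis_inverse by (simp add: algebra_simps)
    also have "cis (real (2 * Suc n) * \<tau> (t k)) = 1" using elim by (intro cis1) simp
    finally have "cis (- 2 * (real (Suc n) * \<tau> (t k))) = 1" by simp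
    then show ?case using inv[of "t k"] elim by simp
  qed
  then have "(\<lambda>k. \<mu> (\<gamma> (t k))) \<longlonglongrightarrow> \<mu> p * (cnj (snd p) / snd p) ^ Suc n"
    by (rule tendsto_eventually)
  from LIMSEQ_unique[OF this mu] show ?thesis .
qed

text \<open>
  Near \<open>(1, 0)\<close> there are points with \<open>z\<^sub>2\<close> of argument \<open>- \<epsilon> \<phi>\<close> for all \<open>\<phi>\<close> between \<open>0\<close> and \<open>\<pi> / n\<close> that
  satisfy the sign condition for \<open>\<epsilon>\<close>.
\<close>

lemma leafwise_constant_on_circle:
  fixes \<epsilon> \<phi> :: real
  assumes \<mu>: "leafwise_constant \<mu>" and \<epsilon>: "\<epsilon> = 1 \<or> \<epsilon> = - 1" and \<phi>: "0 \<le> \<phi>" "real n * \<phi> \<le> pi"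
  shows "\<mu> (1, 0) * cis (2 * \<epsilon> * (real (Suc n) * \<phi>)) = \<mu> (Complex 0 \<epsilon>, 0)"
proof -
  define q where "q = (\<lambda>x. (complex_of_real (cos x), complex_of_real (sin x) * cis (- (\<epsilon> * \<phi>))))"
  have ev: "eventually (\<lambda>x::real. x \<in> {0<..<1}) (at_right 0)"
    by (rule eventually_at_rightI) auto
  have trig: "cos x > 0" "sin x > 0" if "x \<in> {0<..<1}" for x :: real
    using that pi_gt3 by (auto intro!: cos_gt_zero sin_gt_zero)
  have qS: "q x \<in> S3" for x by (simp add: q_def S3_iff norm_mult)
  have val: "\<mu> (q x) * cis (2 * \<epsilon> * (real (Suc n) * \<phi>)) = \<mu> (Complex 0 \<epsilon>, 0)" if x: "x \<in> {0<..<1}" for x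
  proof -
    have "fst (q x) / snd (q x) ^ n = of_real (cos x / sin x ^ n) * cis (real n * (\<epsilon> * \<phi>))"
      by (simp add: q_def power_mult_distrib Complex.DeMoivre divide_inverse cis_inverse)
    then have "\<epsilon> * Im (fst (q x) / snd (q x) ^ n) = cos x / sin x ^ n * (\<epsilon> * sin (\<epsilon> * (real n * \<phi>)))"
      by (simp add: mult.left_commute)
    also have "\<epsilon> * sin (\<epsilon> * (real n * \<phi>)) = sin (real n * \<phi>)" using \<epsilon> by auto
    also have "cos x / sin x ^ n * sin (real n * \<phi>) \<ge> 0"
    proof -
      have "0 \<le> sin (real n * \<phi>)" using \<phi> by (intro sin_ge_zero) auto
      moreover have "0 \<le> cos x / sin x ^ n" using trig[OF x] by simp
      ultimately show ?thesis by (rule mult_nonneg_nonneg[rotated])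
    qed
    finally have "0 \<le> \<epsilon> * Im (fst (q x) / snd (q x) ^ n)" .
    from leafwise_constant_value[OF \<mu> qS _ \<epsilon> this]
    have "\<mu> (q x) * (cnj (snd (q x)) / snd (q x)) ^ Suc n = \<mu> (Complex 0 \<epsilon>, 0)"
      using trig[OF x] by (simp add: q_def)
    moreover have "cnj (snd (q x)) / snd (q x) = cis (2 * \<epsilon> * \<phi>)"
    proof -
      have "cnj (snd (q x)) / snd (q x) = cis (\<epsilon> * \<phi>) / cis (- (\<epsilon> * \<phi>))"
        using trig[OF x] by (simp add: q_def cis_cnj)
      then show ?thesis by (simp add: cis_divide mult.assoc)
    qed
    moreover have "cis (2 * \<epsilon> * \<phi>) ^ Suc n = cis (2 * \<epsilon> * (real (Suc n) * \<phi>))"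
      unfolding Complex.DeMoivre by (simp only: mult_ac)
    ultimately show ?thesis by (simp only:)
  qed
  have "(q \<longlongrightarrow> (of_real (cos 0), of_real (sin 0) * cis (- (\<epsilon> * \<phi>)))) (at_right 0)"
    unfolding q_def by (intro tendsto_intros)
  then have "(q \<longlongrightarrow> (1, 0)) (at_right 0)" by simp
  then have "((\<lambda>x. \<mu> (q x)) \<longlongrightarrow> \<mu> (1, 0)) (at_right 0)"
    using \<mu> qS by (intro continuous_on_tendsto_compose[of S3 \<mu>])
      (auto simp: leafwise_constant_def S3_iff)
  then have "((\<lambda>x. \<mu> (q x) * cis (2 * \<epsilon> * (real (Suc n) * \<phi>))) \<longlongrightarrow>
      \<mu> (1, 0) * cis (2 * \<epsilon> * (real (Suc n) * \<phi>))) (at_right 0)"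
    by (intro tendsto_intros)
  moreover have "((\<lambda>x. \<mu> (q x) * cis (2 * \<epsilon> * (real (Suc n) * \<phi>))) \<longlongrightarrow> \<mu> (Complex 0 \<epsilon>, 0)) (at_right 0)"
    by (rule tendsto_eventually, rule eventually_mono[OF ev]) (rule val)
  ultimately show ?thesis by (rule tendsto_unique[rotated]) simp
qed

text \<open>
  Comparing the arguments \<open>0\<close> and \<open>\<pi> / (2 (n + 1))\<close> in the previous lemma shows that the value at \<open>(1, 0)\<close>
  is its own negative.
\<close>

lemma leafwise_constant_vanishes:
  assumes \<mu>: "leafwise_constant \<mu>" and p: "p \<in> S3"
  shows "\<mu> p = 0"
proof (rule vanish_on_S3_if_vanish_off_axes[OF _ p])
  show "continuous_on S3 \<mu>" using \<mu> by (simp add: leafwise_constant_def)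
  fix q assume q: "q \<in> S3" "fst q \<noteq> 0" "snd q \<noteq> 0"
  define \<epsilon> :: real where "\<epsilon> = (if Im (fst q / snd q ^ n) \<ge> 0 then 1 else - 1)"
  have \<epsilon>: "\<epsilon> = 1 \<or> \<epsilon> = - 1" "0 \<le> \<epsilon> * Im (fst q / snd q ^ n)" by (auto simp: \<epsilon>_def)
  define \<phi> where "\<phi> = pi / (2 * real (Suc n))"
  have \<phi>: "0 \<le> \<phi>" "real n * \<phi> \<le> pi" "real (Suc n) * \<phi> = pi / 2"
    by (simp_all add: \<phi>_def field_simps)
  have "\<mu> (1, 0) = \<mu> (Complex 0 \<epsilon>, 0)"
    using leafwise_constant_on_circle[OF \<mu> \<epsilon>(1), of 0] by simp
  moreover have "cis (2 * \<epsilon> * (real (Suc n) * \<phi>)) = - 1"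
    unfolding \<phi>(3) using \<epsilon>(1) by (auto simp: complex_eq_iff)
  then have "- \<mu> (1, 0) = \<mu> (Complex 0 \<epsilon>, 0)"
    using leafwise_constant_on_circle[OF \<mu> \<epsilon>(1) \<phi>(1,2)] by simp
  ultimately have "\<mu> (Complex 0 \<epsilon>, 0) = 0" by simp
  then show "\<mu> q = 0" using leafwise_constant_value[OF \<mu> q(1,3) \<epsilon>] q by simp
qed

end

section \<open>Uniqueness of the transverse holomorphic structure\<close>

theorem theorem7p3:
  shows "(\<forall>a::complex. a \<notin> \<real> \<longrightarrow>
            formally_integrable (restrict_S3 (omega_a a)) \<and>
            (\<exists>!T. T \<in> transverse_holomorphic_structures (F_a a)) \<and>
            (\<forall>\<omega>'. formally_integrable \<omega>' \<and> foliation_of \<omega>' = F_a a \<longrightarrow>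
               (\<exists>h. smooth_S3 h \<and> (\<forall>p\<in>S3. h p \<noteq> 0) \<and>
                    \<omega>' = (\<lambda>p v. h p * restrict_S3 (omega_a a) p v)))) \<and>
         (\<forall>n::nat. n \<ge> 1 \<longrightarrow>
            formally_integrable (restrict_S3 (omega_n n)) \<and>
            (\<exists>!T. T \<in> transverse_holomorphic_structures (F_n n)) \<and>
            (\<forall>\<omega>'. formally_integrable \<omega>' \<and> foliation_of \<omega>' = F_n n \<longrightarrow>
               (\<exists>h. smooth_S3 h \<and> (\<forall>p\<in>S3. h p \<noteq> 0) \<and>
                    \<omega>' = (\<lambda>p v. h p * restrict_S3 (omega_n n) p v))))"
proof (intro conjI[of "\<forall>a. _ a"] allI impI)
  fix a :: complex assume "a \<notin> \<real>"
  then interpret nonreal_weight a by unfold_locales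
  show "formally_integrable (restrict_S3 (omega_a a)) \<and>
      (\<exists>!T. T \<in> transverse_holomorphic_structures (F_a a)) \<and>
      (\<forall>\<omega>'. formally_integrable \<omega>' \<and> foliation_of \<omega>' = F_a a \<longrightarrow>
        (\<exists>h. smooth_S3 h \<and> (\<forall>p\<in>S3. h p \<noteq> 0) \<and> \<omega>' = (\<lambda>p v. h p * restrict_S3 (omega_a a) p v)))"
    unfolding F_a_def form_eq[symmetric]
    by (rule unique_structure) (rule leafwise_constant_vanishes)
next
  fix n :: nat assume "n \<ge> 1"
  then interpret positive_index n by unfold_locales
  show "formally_integrable (restrict_S3 (omega_n n)) \<and>
      (\<exists>!T. T \<in> transverse_holomorphic_structures (F_n n)) \<and>
      (\<forall>\<omega>'. formally_integrable \<omega>' \<and> foliation_of \<omega>' = F_n n \<longrightarrow>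
        (\<exists>h. smooth_S3 h \<and> (\<forall>p\<in>S3. h p \<noteq> 0) \<and> \<omega>' = (\<lambda>p v. h p * restrict_S3 (omega_n n) p v)))"
    unfolding F_n_def form_eq[symmetric]
    by (rule unique_structure) (rule leafwise_constant_vanishes)
qed

end
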